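(* The following polynomials form a basis for the $\mathbb{Z}_2$-graded identities of the algebra $\mathcal{A}^3$, that is, they generate $\mathrm{Id}_{\mathbb{Z}_2}(\mathcal{A}^3)$ as a $\mathbb{Z}_2$-graded T-ideal: (i) $z_1z_2$; (ii) $[y_1,y_2][y_3,y_4]$; (iii) $[y_1,y_2]z_1$; (iv) $[z_1[y_1,y_2],y_3]$.
   Context: $K$ is a field of characteristic zero, $e_{i,j}$ are the matrix units of $M_3(K)$, and $A = K(e_{1,1}+e_{3,3})\oplus Ke_{2,2}\oplus Ke_{1,2}\oplus Ke_{2,3}\oplus Ke_{1,3}$. $\mathcal{A}^3$ denotes $A$ with the $\mathbb{Z}_2$-grading $A_0=\mathrm{Span}(e_{1,1}+e_{3,3},e_{2,2},e_{2,3})$, $A_1=\mathrm{Span}(e_{1,2},e_{1,3})$. $K\langle Y,Z\rangle$ is the free unital associative algebra on the variables $y_1,y_2,\dots$ of degree $0$ and $z_1,z_2,\dots$ of degree $1$, with the induced $\mathbb{Z}_2$-grading. A polynomial $f(y_1,\dots,y_m,z_1,\dots,z_n)$ is a $\mathbb{Z}_2$-graded identity of a $\mathbb{Z}_2$-graded algebra $B=B_0\oplus B_1$ if it vanishes whenever the $y_i$ are replaced by elements of $B_0$ and the $z_j$ by elements of $B_1$; $\mathrm{Id}_{\mathbb{Z}_2}(B)$ is the ideal of all of them. A $\mathbb{Z}_2$-graded T-ideal is an ideal of $K\langle Y,Z\rangle$ closed under all degree-preserving endomorphisms of $K\langle Y,Z\rangle$. $[a,b]=ab-ba$. *)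

theory Defs
  imports "HOL-Analysis.Cartesian_Space" "HOL-Library.Poly_Mapping" "HOL.Hull"
begin

section \<open>The free unital $\mathbb{Z}_2$-graded algebra\<close>

datatype gvar = Even_Var nat | Odd_Var nat

text \<open>
  Words form a monoid under concatenation, written additively because the convolution product on
  \<^typ>\<open>'a \<Rightarrow>\<^sub>0 'b\<close> asks for an additive monoid of exponents. The type
  \<^typ>\<open>gvar list \<Rightarrow>\<^sub>0 'k\<close> with its library ring structure is then the free unital associative
  algebra on the variables.
\<close>

instantiation list :: (type) monoid_add
begin
definition zero_list :: "'a list" where "zero_list = []"
definition plus_list :: "'a list \<Rightarrow> 'a list \<Rightarrow> 'a list" where "plus_list = (@)"
instance by standard (simp_all add: zero_list_def plus_list_def)
end

type_synonym 'k free_alg = "gvar list \<Rightarrow>\<^sub>0 'k"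

definition yv :: "nat \<Rightarrow> 'k::field free_alg" where
  "yv i = Poly_Mapping.single [Even_Var i] 1"

definition zv :: "nat \<Rightarrow> 'k::field free_alg" where
  "zv i = Poly_Mapping.single [Odd_Var i] 1"

definition scalar :: "'k::field \<Rightarrow> 'k free_alg" where
  "scalar c = Poly_Mapping.single [] c"

definition commutator :: "'a::ring \<Rightarrow> 'a \<Rightarrow> 'a" where
  "commutator a b = a * b - b * a"

definition odd_count :: "gvar list \<Rightarrow> nat" where
  "odd_count w = length (filter (\<lambda>v. \<exists>i. v = Odd_Var i) w)"

definition free_even :: "'k::field free_alg set" where
  "free_even = {f. \<forall>w\<in>Poly_Mapping.keys f. even (odd_count w)}"

definition free_odd :: "'k::field free_alg set" where
  "free_odd = {f. \<forall>w\<in>Poly_Mapping.keys f. odd (odd_count w)}"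

definition graded_endo :: "('k::field free_alg \<Rightarrow> 'k free_alg) \<Rightarrow> bool" where
  "graded_endo \<phi> \<longleftrightarrow>
     \<phi> 1 = 1 \<and>
     (\<forall>f g. \<phi> (f + g) = \<phi> f + \<phi> g) \<and>
     (\<forall>f g. \<phi> (f * g) = \<phi> f * \<phi> g) \<and>
     (\<forall>c f. \<phi> (scalar c * f) = scalar c * \<phi> f) \<and>
     \<phi> ` free_even \<subseteq> free_even \<and> \<phi> ` free_odd \<subseteq> free_odd"

text \<open>Closure under negation and scalar multiples follows from absorption, the algebra being
  unital.\<close>

definition two_sided_ideal :: "'a::ring_1 set \<Rightarrow> bool" where
  "two_sided_ideal I \<longleftrightarrow>
     0 \<in> I \<and> (\<forall>f\<in>I. \<forall>g\<in>I. f + g \<in> I) \<and> (\<forall>f\<in>I. \<forall>g. g * f \<in> I \<and> f * g \<in> I)"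

definition graded_T_ideal :: "'k::field free_alg set \<Rightarrow> bool" where
  "graded_T_ideal I \<longleftrightarrow> two_sided_ideal I \<and> (\<forall>\<phi>. graded_endo \<phi> \<longrightarrow> \<phi> ` I \<subseteq> I)"

section \<open>Graded identities of graded matrix algebras\<close>

text \<open>The library's product \<open>*\<close> on \<^typ>\<open>'k^'n^'n\<close> is componentwise; the matrix product is \<open>**\<close>,
  with unit \<open>mat 1\<close>.\<close>

definition mscale :: "'k::field \<Rightarrow> 'k^'n^'n \<Rightarrow> 'k^'n^'n" where
  "mscale c M = (\<chi> i j. c * M $ i $ j)"

interpretation matsp: vector_space "mscale :: 'k::field \<Rightarrow> 'k^'n^'n \<Rightarrow> 'k^'n^'n"
  by standard (simp_all add: mscale_def vec_eq_iff algebra_simps)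

definition Z2_graded_algebra ::
    "('k::field^'n^'n) set \<Rightarrow> ('k^'n^'n) set \<Rightarrow> ('k^'n^'n) set \<Rightarrow> bool" where
  "Z2_graded_algebra B B0 B1 \<longleftrightarrow>
     matsp.subspace B0 \<and> matsp.subspace B1 \<and>
     B = {a + b | a b. a \<in> B0 \<and> b \<in> B1} \<and> B0 \<inter> B1 = {0} \<and> mat 1 \<in> B \<and>
     (\<forall>a\<in>B0. \<forall>b\<in>B0. a ** b \<in> B0) \<and> (\<forall>a\<in>B0. \<forall>b\<in>B1. a ** b \<in> B1) \<and>
     (\<forall>a\<in>B1. \<forall>b\<in>B0. a ** b \<in> B1) \<and> (\<forall>a\<in>B1. \<forall>b\<in>B1. a ** b \<in> B0)"

definition eval_word :: "(gvar \<Rightarrow> 'k::field^'n^'n) \<Rightarrow> gvar list \<Rightarrow> 'k^'n^'n" where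
  "eval_word \<rho> w = foldr (\<lambda>v M. \<rho> v ** M) w (mat 1)"

definition eval_poly :: "(gvar \<Rightarrow> 'k::field^'n^'n) \<Rightarrow> 'k free_alg \<Rightarrow> 'k^'n^'n" where
  "eval_poly \<rho> f = (\<Sum>w\<in>Poly_Mapping.keys f. mscale (Poly_Mapping.lookup f w) (eval_word \<rho> w))"

definition graded_identities ::
    "('k::field^'n^'n) set \<Rightarrow> ('k^'n^'n) set \<Rightarrow> 'k free_alg set" where
  "graded_identities B0 B1 =
     {f. \<forall>\<rho>. (\<forall>i. \<rho> (Even_Var i) \<in> B0) \<longrightarrow> (\<forall>i. \<rho> (Odd_Var i) \<in> B1) \<longrightarrow> eval_poly \<rho> f = 0}"

section \<open>The algebra and its grading\<close>

definition mat_unit :: "'n \<Rightarrow> 'n \<Rightarrow> 'k::field^'n^'n" where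
  "mat_unit i j = axis i (axis j 1)"

definition algA :: "('k::field^3^3) set" where
  "algA = matsp.span {mat_unit 1 1 + mat_unit 3 3, mat_unit 2 2, mat_unit 1 2, mat_unit 2 3,
                      mat_unit 1 3}"

definition A3_even :: "('k::field^3^3) set" where
  "A3_even = matsp.span {mat_unit 1 1 + mat_unit 3 3, mat_unit 2 2, mat_unit 2 3}"

definition A3_odd :: "('k::field^3^3) set" where
  "A3_odd = matsp.span {mat_unit 1 2, mat_unit 1 3}"

lemma A3_even_iff:
  "M \<in> A3_even \<longleftrightarrow> M$1$1 = M$3$3 \<and> M$1$2 = 0 \<and> M$1$3 = 0 \<and> M$2$1 = 0 \<and> M$3$1 = 0 \<and> M$3$2 = 0"
  (is "_ \<longleftrightarrow> ?P")
proof
  assume "M \<in> A3_even"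
  then show ?P
    unfolding A3_even_def matsp.span_insert
    by (auto simp: mscale_def mat_unit_def axis_def vec_eq_iff forall_3)
next
  assume ?P
  then have "M - mscale (M$1$1) (mat_unit 1 1 + mat_unit 3 3) - mscale (M$2$2) (mat_unit 2 2)
      - mscale (M$2$3) (mat_unit 2 3) = 0"
    by (simp add: mscale_def mat_unit_def axis_def vec_eq_iff forall_3)
  then show "M \<in> A3_even"
    unfolding A3_even_def matsp.span_insert by auto
qed

lemma A3_odd_iff:
  "M \<in> A3_odd \<longleftrightarrow> M$1$1 = 0 \<and> M$2$1 = 0 \<and> M$2$2 = 0 \<and> M$2$3 = 0 \<and> M$3$1 = 0 \<and> M$3$2 = 0 \<and> M$3$3 = 0"
  (is "_ \<longleftrightarrow> ?P")
proof
  assume "M \<in> A3_odd"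
  then show ?P
    unfolding A3_odd_def matsp.span_insert
    by (auto simp: mscale_def mat_unit_def axis_def vec_eq_iff forall_3)
next
  assume ?P
  then have "M - mscale (M$1$2) (mat_unit 1 2) - mscale (M$1$3) (mat_unit 1 3) = 0"
    by (simp add: mscale_def mat_unit_def axis_def vec_eq_iff forall_3)
  then show "M \<in> A3_odd"
    unfolding A3_odd_def matsp.span_insert by auto
qed

lemma A3_graded: "Z2_graded_algebra (algA :: ('k::field^3^3) set) A3_even A3_odd"
proof -
  have "algA = matsp.span ({mat_unit 1 1 + mat_unit 3 3, mat_unit 2 2, mat_unit 2 3} \<union>
                           {mat_unit 1 2, mat_unit 1 3 :: 'k^3^3})"
    unfolding algA_def by (rule arg_cong[where f = matsp.span]) auto
  then have sum: "algA = {a + b | a b :: 'k^3^3. a \<in> A3_even \<and> b \<in> A3_odd}"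
    unfolding matsp.span_Un A3_even_def A3_odd_def by auto
  have one: "mat 1 \<in> (A3_even :: ('k^3^3) set)"
    by (simp add: A3_even_iff mat_def)
  have zero: "0 \<in> (A3_odd :: ('k^3^3) set)"
    by (simp add: A3_odd_iff)
  have "mat 1 \<in> (algA :: ('k^3^3) set)"
    unfolding sum using one zero by force
  moreover have "A3_even \<inter> A3_odd = {0 :: 'k^3^3}"
    by (auto simp: A3_even_iff A3_odd_iff vec_eq_iff forall_3)
  moreover have "matsp.subspace (A3_even :: ('k^3^3) set)" "matsp.subspace (A3_odd :: ('k^3^3) set)"
    by (simp_all add: A3_even_def A3_odd_def matsp.subspace_span)
  ultimately show ?thesis
    unfolding Z2_graded_algebra_def using sum
    by (simp add: A3_even_iff A3_odd_iff matrix_matrix_mult_def sum_3)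
qed

end

theory Submission
  imports Defs "HOL-Library.Multiset"
begin

text \<open>
  Let \<open>I\<close> be the T-ideal generated by the four polynomials. That they are identities is a
  computation with homogeneous elements of the algebra (\<open>basis_ideal_subset_identities\<close>). The other inclusion compares
  a spanning set of the free algebra modulo \<open>I\<close> with the values of its members on generic elements.

  Modulo \<open>I\<close>, every polynomial is a linear combination of normal forms of four kinds
  (\<open>normal_forms_span\<close>):
  \<open>y\<^sup>m\<close>, \<open>y\<^sup>m c\<close>, \<open>y\<^sup>m z\<^sub>k y\<^sup>n\<close> and \<open>y\<^sup>m z\<^sub>k c\<close>, where \<open>y\<^sup>m\<close> is a sorted monomial and
  \<open>c = [y\<^sub>i, y\<^sub>j, y\<^sub>a, y\<^sub>b, \<dots>]\<close> is a left-normed commutator with \<open>j < i\<close>, with \<open>j\<close> at most each later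
  index, and with the later indices in a fixed order. The reasons are these. Two odd variables give
  \<open>0\<close> since \<open>z\<^sub>k u\<close> is odd for even \<open>u\<close>. Even variables commute to the left of an odd variable or
  of a commutator. The later entries of \<open>c\<close> may be permuted because products of commutators
  vanish, and the Jacobi identity moves the smallest index to the second place. Finally
  \<open>z\<^sub>k c y = y z\<^sub>k c\<close> turns \<open>z\<^sub>k y c = z\<^sub>k c y - z\<^sub>k [c, y]\<close> into normal forms.

  The coefficients of a linear combination that is an identity vanish. Let \<open>y\<^sub>i\<close> be the even element
  with diagonal \<open>(a\<^sub>i, b\<^sub>i, a\<^sub>i)\<close> and \<open>(2, 3)\<close> entry \<open>d\<^sub>i\<close>, and let \<open>z\<^sub>k\<close> be \<open>p\<^sub>k e\<^sub>1\<^sub>2\<close>. The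
  four kinds are read off from the entries \<open>(2, 2)\<close>, \<open>(2, 3)\<close>, \<open>(1, 2)\<close> and \<open>(1, 3)\<close>. With
  \<open>t = a - b\<close> the commutator \<open>c\<close> has the single entry
  \<open>(d\<^sub>i t\<^sub>j - d\<^sub>j t\<^sub>i) t\<^sub>a t\<^sub>b \<dots>\<close>. For given \<open>i\<close>, the term \<open>d\<^sub>i t\<^sub>j t\<^sub>a t\<^sub>b \<dots>\<close> occurs only in the value
  of that one \<open>c\<close>: in a commutator where \<open>i\<close> is the second index, no index is smaller than \<open>i\<close>.
  So \<open>comm_fun_independent\<close> follows once distinct monomial functions are known to be independent,
  which is Dedekind's lemma on characters (\<open>characters_independent\<close>).
\<close>

section \<open>The free algebra and its evaluations\<close>

abbreviation word :: "gvar list \<Rightarrow> 'k::field free_alg" where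
  "word w \<equiv> Poly_Mapping.single w 1"

lemma word_append: "word (u @ v) = (word u * word v :: 'k::field free_alg)"
  by (simp add: mult_single plus_list_def)

lemma word_Nil: "word [] = (1 :: 'k::field free_alg)"
  by (metis single_one zero_list_def)

lemma word_Cons: "word (x # w) = (word [x] * word w :: 'k::field free_alg)"
  by (simp add: mult_single plus_list_def)

lemma scalar_mult_single: "scalar c * Poly_Mapping.single w d = Poly_Mapping.single w (c * d)"
  by (simp add: scalar_def mult_single plus_list_def)

lemma single_mult_scalar: "Poly_Mapping.single w d * scalar c = Poly_Mapping.single w (d * c)"
  by (simp add: scalar_def mult_single plus_list_def)

lemma single_eq_scalar_word: "Poly_Mapping.single w c = scalar c * word w"
  by (simp add: scalar_mult_single)

lemma free_alg_induct [case_names zero word add]: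
  fixes f :: "'k::field free_alg"
  assumes zero: "P 0"
    and word: "\<And>c w. P (Poly_Mapping.single w c)"
    and add: "\<And>f g. P f \<Longrightarrow> P g \<Longrightarrow> P (f + g)"
  shows "P f"
proof (induction f rule: update_induct)
  case const
  show ?case by (rule zero)
next
  case (update f a b)
  have "Poly_Mapping.update a b f = f + Poly_Mapping.single a b"
    using update by (intro poly_mapping_eqI)
      (auto simp: lookup_update lookup_add lookup_single in_keys_iff when_def)
  with update show ?case by (simp add: add word)
qed

lemma scalar_commute: "scalar c * f = f * (scalar c :: 'k::field free_alg)"
  by (induction f rule: free_alg_induct)
    (simp_all add: distrib_left distrib_right scalar_mult_single single_mult_scalar mult.commute)

lemma scalar_add: "scalar (a + b) = scalar a + scalar b"
  by (simp add: scalar_def single_add)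

lemma scalar_mult: "scalar (a * b) = scalar a * scalar b"
  by (simp add: scalar_def mult_single plus_list_def)

lemma scalar_1: "scalar 1 = 1"
  by (simp add: scalar_def word_Nil)

interpretation falg: vector_space "\<lambda>c f. scalar c * f :: 'k::field free_alg"
  by standard (simp_all add: distrib_left distrib_right scalar_add scalar_mult scalar_1 mult.assoc)

lemma sum_keys_single:
  assumes "\<And>w. F w 0 = (0 :: 'b::comm_monoid_add)"
  shows "(\<Sum>u\<in>Poly_Mapping.keys (Poly_Mapping.single w c). F u (Poly_Mapping.lookup (Poly_Mapping.single w c) u))
       = F w c"
  using assms by (cases "c = 0") simp_all

lemma eval_poly_add: "eval_poly \<rho> (f + g) = eval_poly \<rho> f + eval_poly \<rho> g"
  unfolding eval_poly_def
  by (rule setsum_keys_plus_distrib) (simp_all add: mscale_def vec_eq_iff distrib_right)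

lemma eval_poly_single: "eval_poly \<rho> (Poly_Mapping.single w c) = mscale c (eval_word \<rho> w)"
  unfolding eval_poly_def
  by (rule sum_keys_single) (simp add: mscale_def vec_eq_iff)

lemma eval_poly_zero: "eval_poly \<rho> 0 = 0"
  by (simp add: eval_poly_def)

lemma eval_word_append: "eval_word \<rho> (u @ v) = eval_word \<rho> u ** eval_word \<rho> v"
  by (induction u) (simp_all add: eval_word_def matrix_mul_assoc)

lemma mscale_mult:
  "mscale c M ** mscale d N = mscale (c * d) (M ** N :: 'k::field^'n^'n)"
  by (simp add: mscale_def matrix_matrix_mult_def vec_eq_iff sum_distrib_left algebra_simps)

lemma matrix_add_rdistrib: "(A + B) ** C = A ** C + B ** (C :: 'k::field^'n^'n)"
  by (simp add: matrix_matrix_mult_def vec_eq_iff sum.distrib distrib_right)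

lemma eval_poly_mult: "eval_poly \<rho> (f * g) = eval_poly \<rho> f ** eval_poly \<rho> g"
proof (induction f rule: free_alg_induct)
  case (word c u)
  show ?case
    by (induction g rule: free_alg_induct)
      (simp_all add: eval_poly_zero eval_poly_add eval_poly_single mult_single distrib_left
        matrix_add_ldistrib mscale_mult eval_word_append plus_list_def)
qed (simp_all add: eval_poly_zero eval_poly_add distrib_right matrix_add_rdistrib)

lemma eval_poly_1: "eval_poly \<rho> 1 = mat 1"
  by (simp add: word_Nil[symmetric] eval_poly_single eval_word_def)

lemma eval_poly_uminus: "eval_poly \<rho> (- f) = - eval_poly \<rho> f"
  using eval_poly_add[of \<rho> "- f" f] by (simp add: eval_poly_zero eq_neg_iff_add_eq_0)

lemma eval_poly_diff: "eval_poly \<rho> (f - g) = eval_poly \<rho> f - eval_poly \<rho> g"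
  using eval_poly_add[of \<rho> f "- g"] by (simp add: eval_poly_uminus)

lemma eval_poly_scalar: "eval_poly \<rho> (scalar c * f) = mscale c (eval_poly \<rho> f)"
  by (simp add: eval_poly_mult scalar_def eval_poly_single eval_word_def)
    (metis mscale_mult matrix_mul_lid matsp.scale_one mult.right_neutral)

lemma eval_poly_sum: "eval_poly \<rho> (\<Sum>x\<in>S. f x) = (\<Sum>x\<in>S. eval_poly \<rho> (f x))"
  by (induction S rule: infinite_finite_induct) (simp_all add: eval_poly_zero eval_poly_add)

lemma eval_poly_yv: "eval_poly \<rho> (yv i) = \<rho> (Even_Var i)"
  by (simp add: yv_def eval_poly_single eval_word_def)

lemma eval_poly_zv: "eval_poly \<rho> (zv i) = \<rho> (Odd_Var i)"
  by (simp add: zv_def eval_poly_single eval_word_def)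

lemma eval_poly_commutator:
  "eval_poly \<rho> (commutator f g) = eval_poly \<rho> f ** eval_poly \<rho> g - eval_poly \<rho> g ** eval_poly \<rho> f"
  by (simp add: commutator_def eval_poly_diff eval_poly_mult)

section \<open>Parity\<close>

lemma odd_count_append: "odd_count (u @ v) = odd_count u + odd_count v"
  by (simp add: odd_count_def)

text \<open>
  Indexing the two homogeneous components by the truth value of evenness lets one product rule
  cover all sign cases: the parity of a product is \<open>b = c\<close>.
\<close>

definition parity :: "bool \<Rightarrow> 'k::field free_alg set" where
  "parity b = {f. \<forall>w\<in>Poly_Mapping.keys f. even (odd_count w) = b}"

lemma free_even_eq: "free_even = parity True" and free_odd_eq: "free_odd = parity False"
  by (auto simp: free_even_def free_odd_def parity_def)

lemma parityI: "(\<And>w. w \<in> Poly_Mapping.keys f \<Longrightarrow> even (odd_count w) = b) \<Longrightarrow> f \<in> parity b"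
  and parityD: "f \<in> parity b \<Longrightarrow> w \<in> Poly_Mapping.keys f \<Longrightarrow> even (odd_count w) = b"
  by (auto simp: parity_def)

lemma parity_zero: "0 \<in> parity b"
  by (simp add: parity_def)

lemma parity_add: "f \<in> parity b \<Longrightarrow> g \<in> parity b \<Longrightarrow> f + g \<in> parity b"
  using keys_add[of f g] by (blast intro: parityI dest: parityD)

lemma parity_diff: "f \<in> parity b \<Longrightarrow> g \<in> parity b \<Longrightarrow> f - g \<in> parity b"
  using parity_add[of f b "- g"] by (simp add: parity_def)

lemma parity_mult:
  assumes "f \<in> parity b" "g \<in> parity c"
  shows "f * g \<in> parity (b = c)"
proof (rule parityI)
  fix w assume "w \<in> Poly_Mapping.keys (f * g)"
  then obtain u v where "w = u @ v" "u \<in> Poly_Mapping.keys f" "v \<in> Poly_Mapping.keys g"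
    using keys_mult[of f g] unfolding plus_list_def by blast
  then show "even (odd_count w) = (b = c)"
    using parityD[OF assms(1)] parityD[OF assms(2)] by (simp add: odd_count_append)
qed

lemma parity_single: "even (odd_count w) = b \<Longrightarrow> Poly_Mapping.single w c \<in> parity b"
  by (simp add: parity_def)

lemma parity_commutator: "f \<in> parity b \<Longrightarrow> g \<in> parity c \<Longrightarrow> commutator f g \<in> parity (b = c)"
  unfolding commutator_def using parity_mult[of f b g c] parity_mult[of g c f b]
  by (simp add: parity_diff eq_commute[of c b])

lemma parity_yv: "yv i \<in> parity True" and parity_zv: "zv i \<in> parity False"
  by (simp_all add: yv_def zv_def parity_def odd_count_def)

section \<open>Substitution\<close>

text \<open>
  The endomorphism that the free algebra owes to its universal property.
\<close>

definition subst :: "(gvar \<Rightarrow> 'k::field free_alg) \<Rightarrow> 'k free_alg \<Rightarrow> 'k free_alg" where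
  "subst \<sigma> f = (\<Sum>w\<in>Poly_Mapping.keys f. scalar (Poly_Mapping.lookup f w) * prod_list (map \<sigma> w))"

lemma subst_add: "subst \<sigma> (f + g) = subst \<sigma> f + subst \<sigma> g"
  unfolding subst_def by (rule setsum_keys_plus_distrib) (simp_all add: scalar_add distrib_right)

lemma subst_single: "subst \<sigma> (Poly_Mapping.single w c) = scalar c * prod_list (map \<sigma> w)"
  unfolding subst_def by (rule sum_keys_single) simp

lemma subst_zero: "subst \<sigma> 0 = 0"
  by (simp add: subst_def)

lemma subst_diff: "subst \<sigma> (f - g) = subst \<sigma> f - subst \<sigma> g"
  using subst_add[of \<sigma> "f - g" g] by simp

lemma scalar_mult_mult: "(scalar c * f) * (scalar d * g) = scalar (c * d) * (f * g :: 'k::field free_alg)"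
  by (metis (no_types, lifting) mult.assoc scalar_commute scalar_mult)

lemma subst_mult: "subst \<sigma> (f * g) = subst \<sigma> f * subst \<sigma> g"
proof (induction f rule: free_alg_induct)
  case (word c u)
  show ?case
    by (induction g rule: free_alg_induct)
      (simp_all add: subst_zero subst_add subst_single mult_single distrib_left plus_list_def
        scalar_mult_mult)
qed (simp_all add: subst_zero subst_add distrib_right)

lemma subst_parity:
  assumes "\<And>i. \<sigma> (Even_Var i) \<in> parity True" "\<And>i. \<sigma> (Odd_Var i) \<in> parity False"
    and "f \<in> parity b"
  shows "subst \<sigma> f \<in> parity b"
proof -
  have prod: "prod_list (map \<sigma> w) \<in> parity (even (odd_count w))" for w
  proof (induction w)
    case Nil
    show ?case
      by (simp add: word_Nil[symmetric] parity_def odd_count_def)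
  next
    case (Cons v w)
    then show ?case
      using parity_mult[of "\<sigma> v" "even (odd_count [v])" "prod_list (map \<sigma> w)"] assms(1,2)
        odd_count_append[of "[v]" w]
      by (cases v) (auto simp: odd_count_def)
  qed
  have "scalar c * g \<in> parity b" if "g \<in> parity b" for c and g :: "'a free_alg"
    using parity_mult[OF parity_single that, of "[]" True c]
    by (simp add: odd_count_def scalar_def)
  moreover have "(\<Sum>w\<in>S. h w) \<in> parity b" if "\<And>w. w \<in> S \<Longrightarrow> h w \<in> parity b"
    for S and h :: "gvar list \<Rightarrow> 'a free_alg"
    using that by (induction S rule: infinite_finite_induct) (auto intro: parity_zero parity_add)
  moreover have "prod_list (map \<sigma> w) \<in> parity b" if "w \<in> Poly_Mapping.keys f" for w
    using prod[of w] that assms(3) by (simp add: parity_def)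
  ultimately show ?thesis
    by (simp add: subst_def)
qed

lemma graded_endo_subst:
  assumes "\<And>i. \<sigma> (Even_Var i) \<in> parity True" "\<And>i. \<sigma> (Odd_Var i) \<in> parity False"
  shows "graded_endo (subst \<sigma>)"
proof -
  have scalar: "subst \<sigma> (scalar c) = scalar c" for c
    by (simp add: scalar_def[of c] subst_single)
  then have "subst \<sigma> (scalar c * f) = scalar c * subst \<sigma> f" for c f
    by (simp add: subst_mult)
  moreover have "subst \<sigma> 1 = 1"
    using scalar[of 1] by (simp add: scalar_1)
  ultimately show ?thesis
    using subst_parity[OF assms]
    by (auto simp: graded_endo_def subst_add subst_mult free_even_eq free_odd_eq)
qed

section \<open>The T-ideal of the basis polynomials\<close>

definition basis_polys :: "'k::field free_alg set" where
  "basis_polys =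
     {zv 1 * zv 2,
      commutator (yv 1) (yv 2) * commutator (yv 3) (yv 4),
      commutator (yv 1) (yv 2) * zv 1,
      commutator (zv 1 * commutator (yv 1) (yv 2)) (yv 3)}"

definition basis_ideal :: "'k::field free_alg set" where
  "basis_ideal = graded_T_ideal hull basis_polys"

lemma graded_T_ideal_basis_ideal: "graded_T_ideal basis_ideal"
  unfolding basis_ideal_def
  by (rule hull_in) (auto simp: graded_T_ideal_def two_sided_ideal_def image_subset_iff)

lemma ideal_zero: "0 \<in> basis_ideal"
  and ideal_add: "f \<in> basis_ideal \<Longrightarrow> g \<in> basis_ideal \<Longrightarrow> f + g \<in> basis_ideal"
  and ideal_mult_left: "f \<in> basis_ideal \<Longrightarrow> g * f \<in> basis_ideal"
  and ideal_mult_right: "f \<in> basis_ideal \<Longrightarrow> f * g \<in> basis_ideal"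
  using graded_T_ideal_basis_ideal by (auto simp: graded_T_ideal_def two_sided_ideal_def)

lemma ideal_diff: "f \<in> basis_ideal \<Longrightarrow> g \<in> basis_ideal \<Longrightarrow> f - g \<in> basis_ideal"
  using ideal_add[of f "- g"] ideal_mult_left[of g "- 1"] by simp

lemma ideal_subspace: "falg.subspace basis_ideal"
  by (auto simp: falg.subspace_def ideal_zero ideal_add ideal_mult_left)

text \<open>
  Each polynomial may be evaluated at arbitrary homogeneous elements of the right parity, since
  such a substitution is a graded endomorphism.
\<close>

lemma basis_polys_instances:
  fixes f\<^sub>1 f\<^sub>2 f\<^sub>3 f\<^sub>4 g\<^sub>1 g\<^sub>2 :: "'k::field free_alg"
  assumes f: "f\<^sub>1 \<in> parity True" "f\<^sub>2 \<in> parity True" "f\<^sub>3 \<in> parity True" "f\<^sub>4 \<in> parity True"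
    and g: "g\<^sub>1 \<in> parity False" "g\<^sub>2 \<in> parity False"
  shows "g\<^sub>1 * g\<^sub>2 \<in> basis_ideal"
    and "commutator f\<^sub>1 f\<^sub>2 * commutator f\<^sub>3 f\<^sub>4 \<in> basis_ideal"
    and "commutator f\<^sub>1 f\<^sub>2 * g\<^sub>1 \<in> basis_ideal"
    and "commutator (g\<^sub>1 * commutator f\<^sub>1 f\<^sub>2) f\<^sub>3 \<in> basis_ideal"
proof -
  define \<sigma> where "\<sigma> v = (case v of
      Even_Var i \<Rightarrow> if i = 1 then f\<^sub>1 else if i = 2 then f\<^sub>2 else if i = 3 then f\<^sub>3 else f\<^sub>4
    | Odd_Var i \<Rightarrow> if i = 1 then g\<^sub>1 else g\<^sub>2)" for v
  have "graded_endo (subst \<sigma>)"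
    by (rule graded_endo_subst) (simp_all add: \<sigma>_def f g)
  then have *: "subst \<sigma> p \<in> basis_ideal" if "p \<in> basis_polys" for p
    using that graded_T_ideal_basis_ideal hull_inc[of p basis_polys graded_T_ideal]
    unfolding graded_T_ideal_def basis_ideal_def by blast
  have var: "subst \<sigma> (yv i) = \<sigma> (Even_Var i)" "subst \<sigma> (zv i) = \<sigma> (Odd_Var i)" for i
    by (simp_all add: yv_def zv_def subst_single scalar_1)
  have comm: "subst \<sigma> (commutator p q) = commutator (subst \<sigma> p) (subst \<sigma> q)" for p q
    by (simp add: commutator_def subst_diff subst_mult)
  show "g\<^sub>1 * g\<^sub>2 \<in> basis_ideal"
    using *[of "zv 1 * zv 2"] by (simp add: basis_polys_def subst_mult var \<sigma>_def)
  show "commutator f\<^sub>1 f\<^sub>2 * commutator f\<^sub>3 f\<^sub>4 \<in> basis_ideal"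
    using *[of "commutator (yv 1) (yv 2) * commutator (yv 3) (yv 4)"]
    by (simp add: basis_polys_def subst_mult comm var \<sigma>_def)
  show "commutator f\<^sub>1 f\<^sub>2 * g\<^sub>1 \<in> basis_ideal"
    using *[of "commutator (yv 1) (yv 2) * zv 1"]
    by (simp add: basis_polys_def subst_mult comm var \<sigma>_def)
  show "commutator (g\<^sub>1 * commutator f\<^sub>1 f\<^sub>2) f\<^sub>3 \<in> basis_ideal"
    using *[of "commutator (zv 1 * commutator (yv 1) (yv 2)) (yv 3)"]
    by (simp add: basis_polys_def subst_mult comm var \<sigma>_def)
qed

text \<open>
  The same facts with the surplus variables set to \<open>0\<close>, which has both parities.
\<close>

lemmas odd_mult_odd_ideal =
    basis_polys_instances(1)[OF parity_zero parity_zero parity_zero parity_zero]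
  and comm_mult_comm_ideal = basis_polys_instances(2)[OF _ _ _ _ parity_zero parity_zero]
  and comm_mult_odd_ideal = basis_polys_instances(3)[OF _ _ parity_zero parity_zero _ parity_zero]
  and comm_odd_mult_comm_ideal = basis_polys_instances(4)[OF _ _ _ parity_zero _ parity_zero]

definition cong_ideal :: "'k::field free_alg \<Rightarrow> 'k free_alg \<Rightarrow> bool" (infix "\<approx>" 50) where
  "f \<approx> g \<longleftrightarrow> f - g \<in> basis_ideal"

lemma cong_refl [simp]: "f \<approx> f"
  by (simp add: cong_ideal_def ideal_zero)

lemma cong_sym: "f \<approx> g \<Longrightarrow> g \<approx> f"
  unfolding cong_ideal_def using ideal_diff[OF ideal_zero, of "f - g"] by simp

lemma cong_trans [trans]: "f \<approx> g \<Longrightarrow> g \<approx> h \<Longrightarrow> f \<approx> h"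
  unfolding cong_ideal_def using ideal_add[of "f - g" "g - h"] by simp

lemma cong_diff: "f \<approx> f' \<Longrightarrow> g \<approx> g' \<Longrightarrow> f - g \<approx> f' - g'"
  unfolding cong_ideal_def using ideal_diff[of "f - f'" "g - g'"] by (simp add: algebra_simps)

lemma cong_mult_left: "f \<approx> g \<Longrightarrow> h * f \<approx> h * g"
  unfolding cong_ideal_def using ideal_mult_left[of "f - g" h] by (simp add: algebra_simps)

lemma cong_mult_right: "f \<approx> g \<Longrightarrow> f * h \<approx> g * h"
  unfolding cong_ideal_def using ideal_mult_right[of "f - g" h] by (simp add: algebra_simps)

lemma cong_commutator: "f \<approx> g \<Longrightarrow> commutator f h \<approx> commutator g h"
  unfolding commutator_def by (intro cong_diff cong_mult_left cong_mult_right)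

section \<open>Elements that behave like commutators\<close>

text \<open>
  Even variables may be reordered freely to the left of such elements; these include all odd
  elements and all commutators of even elements.
\<close>

definition comm_annihilated :: "'k::field free_alg set" where
  "comm_annihilated =
     {h. \<forall>f\<in>parity True. \<forall>g\<in>parity True. commutator f g * h \<in> basis_ideal}"

text \<open>
  The properties that the defining relations give to a commutator of even elements, stated so
  that they survive multiplication by even elements on both sides. Hence they hold on the whole
  ideal that these commutators generate in the even part.
\<close>

definition commutator_like :: "'k::field free_alg set" where
  "commutator_like = {c \<in> parity True \<inter> comm_annihilated.
     (\<forall>f\<in>parity True. \<forall>g\<in>parity True. c * commutator f g \<in> basis_ideal) \<and>
     (\<forall>h\<in>parity False. \<forall>f\<in>parity True. commutator (h * c) f \<in> basis_ideal)}"

lemma parity_even_mult: "f \<in> parity True \<Longrightarrow> g \<in> parity b \<Longrightarrow> f * g \<in> parity b"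
  and parity_mult_even: "f \<in> parity b \<Longrightarrow> g \<in> parity True \<Longrightarrow> f * g \<in> parity b"
  using parity_mult[of f True g b] parity_mult[of f b g True] by simp_all

lemma odd_comm_annihilated: "h \<in> parity False \<Longrightarrow> h \<in> comm_annihilated"
  by (simp add: comm_annihilated_def comm_mult_odd_ideal)

text \<open>
  By the Leibniz rule, \<open>[f, g] u = [f, g u] - g [f, u]\<close>: the factor \<open>u\<close> between a commutator and \<open>h\<close>
  is absorbed into commutators that stand next to \<open>h\<close>.
\<close>

lemma comm_annihilated_mult_left:
  assumes h: "h \<in> comm_annihilated" and u: "u \<in> parity True"
  shows "u * h \<in> comm_annihilated"
proof -
  have "commutator f g * (u * h) \<in> basis_ideal" if "f \<in> parity True" "g \<in> parity True" for f g
  proof -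
    have "commutator f g * (u * h) = commutator f (g * u) * h - g * (commutator f u * h)"
      by (simp add: commutator_def algebra_simps)
    then show ?thesis
      using h u that by (simp add: comm_annihilated_def ideal_diff ideal_mult_left parity_even_mult)
  qed
  then show ?thesis
    by (simp add: comm_annihilated_def)
qed

lemma comm_annihilated_mult_right: "h \<in> comm_annihilated \<Longrightarrow> h * u \<in> comm_annihilated"
  by (auto simp: comm_annihilated_def mult.assoc[symmetric] intro: ideal_mult_right)

lemma commutator_like_left:
  assumes c: "c \<in> commutator_like" and u: "u \<in> parity True"
  shows "u * c \<in> commutator_like"
proof -
  have "u * c * commutator f g \<in> basis_ideal" if "f \<in> parity True" "g \<in> parity True" for f g
    using c that by (auto simp: commutator_like_def mult.assoc intro: ideal_mult_left)
  moreover have "commutator (h * (u * c)) f \<in> basis_ideal"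
    if "h \<in> parity False" "f \<in> parity True" for h f
    using c that parity_mult_even[OF that(1) u] by (simp add: commutator_like_def mult.assoc[symmetric])
  ultimately show ?thesis
    using c u by (simp add: commutator_like_def parity_even_mult comm_annihilated_mult_left)
qed

text \<open>
  The last relation is the delicate one: \<open>h c u\<close> agrees with \<open>(u h) c\<close> modulo the ideal, and \<open>u h\<close>
  is again odd.
\<close>

lemma commutator_like_right:
  assumes c: "c \<in> commutator_like" and u: "u \<in> parity True"
  shows "c * u \<in> commutator_like"
proof -
  have "c * u * commutator f g \<in> basis_ideal" if "f \<in> parity True" "g \<in> parity True" for f g
  proof -
    have "c * u * commutator f g = c * commutator (u * f) g - c * commutator u g * f"
      by (simp add: commutator_def algebra_simps)
    then show ?thesis
      using c u that
      by (simp add: commutator_like_def ideal_diff ideal_mult_right parity_even_mult)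
  qed
  moreover have "commutator (h * (c * u)) f \<in> basis_ideal"
    if h: "h \<in> parity False" and f: "f \<in> parity True" for h f
  proof -
    have "h * (c * u) \<approx> (u * h) * c"
      using c h u by (simp add: commutator_like_def cong_ideal_def commutator_def mult.assoc)
    then have "commutator (h * (c * u)) f \<approx> commutator ((u * h) * c) f"
      by (rule cong_commutator)
    moreover have "commutator ((u * h) * c) f \<approx> 0"
      using c parity_even_mult[OF u h] f by (simp add: commutator_like_def cong_ideal_def)
    ultimately show ?thesis
      using cong_trans by (fastforce simp: cong_ideal_def)
  qed
  ultimately show ?thesis
    using c u by (simp add: commutator_like_def parity_mult_even comm_annihilated_mult_right)
qed

lemma commutator_like_diff: "c \<in> commutator_like \<Longrightarrow> d \<in> commutator_like \<Longrightarrow> c - d \<in> commutator_like"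
proof -
  assume *: "c \<in> commutator_like" "d \<in> commutator_like"
  have "commutator (h * (c - d)) f = commutator (h * c) f - commutator (h * d) f" for h f
    by (simp add: commutator_def algebra_simps)
  then show ?thesis
    using * by (simp add: commutator_like_def comm_annihilated_def parity_diff
        left_diff_distrib right_diff_distrib ideal_diff)
qed

lemma commutator_commutator_like:
  "f \<in> parity True \<Longrightarrow> g \<in> parity True \<Longrightarrow> commutator f g \<in> commutator_like"
  using parity_commutator[of f True g True]
  by (simp add: commutator_like_def comm_annihilated_def comm_mult_comm_ideal
      comm_odd_mult_comm_ideal)

lemma commutator_like_commutator:
  "c \<in> commutator_like \<Longrightarrow> u \<in> parity True \<Longrightarrow> commutator c u \<in> commutator_like"
  unfolding commutator_def by (intro commutator_like_diff commutator_like_left commutator_like_right)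

lemma commutator_like_comm_annihilated: "c \<in> commutator_like \<Longrightarrow> c \<in> comm_annihilated"
  and commutator_like_even: "c \<in> commutator_like \<Longrightarrow> c \<in> parity True"
  by (simp_all add: commutator_like_def)

section \<open>Sorted monomials and iterated commutators\<close>

definition yword :: "nat list \<Rightarrow> 'k::field free_alg" where
  "yword l = prod_list (map yv l)"

definition ymon :: "nat multiset \<Rightarrow> 'k::field free_alg" where
  "ymon m = yword (sorted_list_of_multiset m)"

lemma yword_simps [simp]:
  "yword [] = 1" "yword (k # l) = yv k * yword l" "yword (l @ l') = yword l * yword l'"
  by (simp_all add: yword_def)

lemma parity_yword: "yword l \<in> parity True"
proof (induction l)
  case Nil
  show ?case
    by (simp add: parity_def odd_count_def zero_list_def)
qed (simp add: parity_even_mult parity_yv)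

lemma parity_ymon: "ymon m \<in> parity True"
  by (simp add: ymon_def parity_yword)

lemma yv_mult_yword_cong:
  assumes h: "h \<in> comm_annihilated"
  shows "yv k * yword l * h \<approx> yword (insort k l) * h"
proof (induction l)
  case (Cons x l)
  have "commutator (yv k) (yv x) * (yword l * h) \<in> basis_ideal"
    using comm_annihilated_mult_left[OF h parity_yword[of l]]
    by (simp add: comm_annihilated_def parity_yv)
  then have "yv k * yv x * yword l * h \<approx> yv x * (yv k * yword l * h)"
    by (simp add: cong_ideal_def commutator_def algebra_simps)
  also have "\<dots> \<approx> yv x * (yword (insort k l) * h)"
    by (rule cong_mult_left) (rule Cons.IH)
  finally show ?case
    by (simp add: mult.assoc)
qed simp

lemma yv_mult_ymon_cong:
  "h \<in> comm_annihilated \<Longrightarrow> yv k * ymon m * h \<approx> ymon (add_mset k m) * h"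
  by (simp add: ymon_def yv_mult_yword_cong)

lemma yword_cong_ymon:
  assumes "h \<in> comm_annihilated"
  shows "yword l * h \<approx> ymon (mset l) * h"
proof (induction l)
  case (Cons k l)
  have "yv k * (yword l * h) \<approx> yv k * (ymon (mset l) * h)"
    using Cons by (rule cong_mult_left)
  also have "\<dots> \<approx> ymon (add_mset k (mset l)) * h"
    using yv_mult_ymon_cong[OF assms] by (simp add: mult.assoc)
  finally show ?case
    by (simp add: mult.assoc)
qed (simp add: ymon_def)

text \<open>
  The head of the list is the outermost entry, so that appending a further commutator is \<open>Cons\<close> and
  sorting the entries is insertion sort.
\<close>

primrec iter_comm :: "'k::field free_alg \<Rightarrow> nat list \<Rightarrow> 'k free_alg" where
  "iter_comm c [] = c"
| "iter_comm c (k # l) = commutator (iter_comm c l) (yv k)"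

lemma commutator_diff_left: "commutator (a - b) c = commutator a c - commutator b (c :: 'a::ring)"
  by (simp add: commutator_def algebra_simps)

lemma iter_comm_diff: "iter_comm (c - d) l = iter_comm c l - iter_comm d l"
  by (induction l) (simp_all add: commutator_diff_left)

lemma iter_comm_commutator_like: "c \<in> commutator_like \<Longrightarrow> iter_comm c l \<in> commutator_like"
  by (induction l) (simp_all add: commutator_like_commutator parity_yv)

text \<open>
  The two sides differ by \<open>[c, [u, v]]\<close>, and \<open>c [u, v]\<close> and \<open>[u, v] c\<close> both lie in the ideal.
\<close>

lemma commutator_swap_cong:
  assumes c: "c \<in> commutator_like" and "u \<in> parity True" "v \<in> parity True"
  shows "commutator (commutator c u) v \<approx> commutator (commutator c v) u"
proof -
  have "c * commutator u v - commutator u v * c \<in> basis_ideal"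
    using assms by (auto simp: commutator_like_def comm_annihilated_def intro: ideal_diff)
  then show ?thesis
    by (simp add: cong_ideal_def commutator_def algebra_simps)
qed

lemma iter_comm_insort_cong:
  assumes c: "c \<in> commutator_like"
  shows "commutator (iter_comm c l) (yv k) \<approx> iter_comm c (insort k l)"
proof (induction l)
  case (Cons x l)
  have "commutator (commutator (iter_comm c l) (yv x)) (yv k)
      \<approx> commutator (commutator (iter_comm c l) (yv k)) (yv x)"
    using c by (intro commutator_swap_cong iter_comm_commutator_like parity_yv)
  also have "\<dots> \<approx> commutator (iter_comm c (insort k l)) (yv x)"
    by (rule cong_commutator) (rule Cons.IH)
  finally show ?case
    by simp
qed simp

lemma iter_comm_commutator_cong:
  assumes c: "c \<in> commutator_like"
  shows "commutator (iter_comm c l) (yv k) \<approx> iter_comm (commutator c (yv k)) l"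
proof (induction l)
  case (Cons x l)
  have "commutator (commutator (iter_comm c l) (yv x)) (yv k)
      \<approx> commutator (commutator (iter_comm c l) (yv k)) (yv x)"
    using c by (intro commutator_swap_cong iter_comm_commutator_like parity_yv)
  also have "\<dots> \<approx> commutator (iter_comm (commutator c (yv k)) l) (yv x)"
    by (rule cong_commutator) (rule Cons.IH)
  finally show ?case
    by simp
qed simp

section \<open>The normal forms span the free algebra modulo the T-ideal\<close>

text \<open>
  Including the ideal among the generators makes this the linear span modulo the ideal.
\<close>

definition mspan :: "'k::field free_alg set \<Rightarrow> 'k free_alg set" where
  "mspan X = falg.span (X \<union> basis_ideal)"

lemma mspan_base: "f \<in> X \<Longrightarrow> f \<in> mspan X"
  and mspan_ideal: "f \<in> basis_ideal \<Longrightarrow> f \<in> mspan X"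
  by (auto simp: mspan_def intro: falg.span_base)

lemma mspan_zero: "0 \<in> mspan X"
  and mspan_add: "f \<in> mspan X \<Longrightarrow> g \<in> mspan X \<Longrightarrow> f + g \<in> mspan X"
  and mspan_diff: "f \<in> mspan X \<Longrightarrow> g \<in> mspan X \<Longrightarrow> f - g \<in> mspan X"
  and mspan_scale: "f \<in> mspan X \<Longrightarrow> scalar c * f \<in> mspan X"
  unfolding mspan_def by (rule falg.span_zero falg.span_add falg.span_diff falg.span_scale; assumption)+

lemma mspan_mono: "X \<subseteq> Y \<Longrightarrow> mspan X \<subseteq> mspan Y"
  unfolding mspan_def by (rule falg.span_mono) blast

lemma mspan_cong: "f \<approx> g \<Longrightarrow> g \<in> mspan X \<Longrightarrow> f \<in> mspan X"
  using mspan_add[OF mspan_ideal[of "f - g"], of g X] by (simp add: cong_ideal_def)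

lemma mspan_mult:
  assumes "f \<in> mspan X" and X: "\<And>x. x \<in> X \<Longrightarrow> u * x * v \<in> mspan Y"
  shows "u * f * v \<in> mspan Y"
  using assms(1) unfolding mspan_def
proof (induction rule: falg.span_induct_alt)
  case base
  show ?case
    by (simp add: falg.span_zero)
next
  case (step c x f)
  have "u * x * v \<in> mspan Y"
    using step(1) X by (auto intro: mspan_ideal ideal_mult_left ideal_mult_right)
  then have "scalar c * (u * x * v) + u * f * v \<in> mspan Y"
    using step(2) by (auto simp: mspan_def intro: falg.span_add falg.span_scale)
  moreover have "u * (scalar c * x + f) * v = scalar c * (u * x * v) + u * f * v"
    by (simp add: algebra_simps) (metis mult.assoc scalar_commute)
  ultimately show ?case
    by (simp add: mspan_def)
qed

lemmas mspan_mult_left = mspan_mult[where v = 1, simplified]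
  and mspan_mult_right = mspan_mult[where u = 1, simplified]

text \<open>
  Among the commutators with the indices \<open>i\<close>, \<open>j\<close> and \<open>J\<close>, the Jacobi identity leaves those with the
  smallest index in second place.
\<close>

definition comm_index :: "(nat \<times> nat \<times> nat multiset) set" where
  "comm_index = {(i, j, J). j < i \<and> (\<forall>x\<in>#J. j \<le> x)}"

definition nf_comm :: "nat \<times> nat \<times> nat multiset \<Rightarrow> 'k::field free_alg" where
  "nf_comm = (\<lambda>(i, j, J). iter_comm (commutator (yv i) (yv j)) (sorted_list_of_multiset J))"

lemma nf_comm_eq:
  "nf_comm (i, j, J) = iter_comm (commutator (yv i) (yv j)) (sorted_list_of_multiset J)"
  by (simp add: nf_comm_def)

lemma yv_commutator_like: "commutator (yv i) (yv j) \<in> commutator_like"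
  by (simp add: commutator_commutator_like parity_yv)

lemma nf_comm_commutator_like: "nf_comm s \<in> commutator_like"
  by (cases s) (simp add: nf_comm_eq iter_comm_commutator_like yv_commutator_like)

lemma yv_commutator_in_mspan: "commutator (yv i) (yv j) \<in> mspan (nf_comm ` comm_index)"
proof -
  have *: "commutator (yv i) (yv j) \<in> mspan (nf_comm ` comm_index)" if "j < i" for i j
    using that by (intro mspan_base image_eqI[where x = "(i, j, {#})"]) (auto simp: comm_index_def nf_comm_eq)
  have "commutator (yv i) (yv j) = 0 - commutator (yv j) (yv i :: 'a free_alg)"
    by (simp add: commutator_def)
  then show ?thesis
    using *[of j i] *[of i j] mspan_diff[OF mspan_zero] mspan_zero
    by (cases i j rule: linorder_cases) (fastforce simp: commutator_def)+
qed

lemma nf_comm_add_cong: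
  "commutator (nf_comm (i, j, J)) (yv k) \<approx> nf_comm (i, j, add_mset k J)"
  by (simp add: nf_comm_eq iter_comm_insort_cong yv_commutator_like)

text \<open>
  If the new index \<open>k\<close> is below \<open>j\<close>, it is moved inwards and the Jacobi identity
  \<open>[y\<^sub>i, y\<^sub>j, y\<^sub>k] = [y\<^sub>i, y\<^sub>k, y\<^sub>j] - [y\<^sub>j, y\<^sub>k, y\<^sub>i]\<close> puts it in second place, where it is the smallest.
\<close>

lemma nf_comm_commutator:
  assumes "s \<in> comm_index"
  shows "commutator (nf_comm s) (yv k) \<in> mspan (nf_comm ` comm_index :: 'k::field free_alg set)"
proof -
  obtain i j J where s: "s = (i, j, J)" and ij: "j < i" and J: "\<forall>x\<in>#J. j \<le> x"
    using assms by (auto simp: comm_index_def)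
  show ?thesis
  proof (cases "j \<le> k")
    case True
    then have "(i, j, add_mset k J) \<in> comm_index"
      using ij J by (auto simp: comm_index_def)
    then show ?thesis
      unfolding s by (intro mspan_cong[OF nf_comm_add_cong] mspan_base imageI)
  next
    case False
    let ?l = "sorted_list_of_multiset J"
    have reorder: "iter_comm (commutator (commutator (yv a) (yv k)) (yv b)) ?l
        \<in> mspan (nf_comm ` comm_index :: 'k free_alg set)" if "k < a" "k < b" for a b
    proof -
      have "iter_comm (commutator (commutator (yv a) (yv k)) (yv b)) ?l
          \<approx> commutator (nf_comm (a, k, J)) (yv b :: 'k free_alg)"
        using cong_sym[OF iter_comm_commutator_cong[OF yv_commutator_like, of a k ?l b]]
        by (simp add: nf_comm_eq)
      also have "\<dots> \<approx> nf_comm (a, k, add_mset b J)"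
        by (rule nf_comm_add_cong)
      finally have "iter_comm (commutator (commutator (yv a) (yv k)) (yv b)) ?l
          \<approx> (nf_comm (a, k, add_mset b J) :: 'k free_alg)" .
      moreover have "(a, k, add_mset b J) \<in> comm_index"
        using that J False by (fastforce simp: comm_index_def)
      ultimately show ?thesis
        by (blast intro: mspan_cong mspan_base)
    qed
    have "commutator (commutator (yv i) (yv j)) (yv k)
        = commutator (commutator (yv i) (yv k)) (yv j)
        - commutator (commutator (yv j) (yv k)) (yv i :: 'k free_alg)"
      by (simp add: commutator_def algebra_simps)
    moreover have "commutator (nf_comm s) (yv k)
        \<approx> iter_comm (commutator (commutator (yv i) (yv j)) (yv k :: 'k free_alg)) ?l"
      unfolding s nf_comm_eq by (rule iter_comm_commutator_cong[OF yv_commutator_like])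
    ultimately have "commutator (nf_comm s) (yv k)
        \<approx> iter_comm (commutator (commutator (yv i) (yv k)) (yv j)) ?l
          - iter_comm (commutator (commutator (yv j) (yv k)) (yv i :: 'k free_alg)) ?l"
      by (simp add: iter_comm_diff)
    then show ?thesis
      by (rule mspan_cong) (use reorder ij False in \<open>auto intro!: mspan_diff\<close>)
  qed
qed

definition comm_forms :: "'k::field free_alg set" where
  "comm_forms = {ymon m * nf_comm s | m s. s \<in> comm_index}"

lemma ymon_empty [simp]: "ymon {#} = 1"
  by (simp add: ymon_def)

lemma comm_formsI: "s \<in> comm_index \<Longrightarrow> ymon m * nf_comm s \<in> mspan comm_forms"
  unfolding comm_forms_def by (rule mspan_base) blast

lemma yv_mult_comm_forms:
  assumes "f \<in> mspan comm_forms"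
  shows "yv k * f \<in> mspan comm_forms"
  using assms
proof (rule mspan_mult_left)
  fix x :: "'a free_alg" assume "x \<in> comm_forms"
  then obtain m s where x: "x = ymon m * nf_comm s" and s: "s \<in> comm_index"
    unfolding comm_forms_def by blast
  have "yv k * x \<approx> ymon (add_mset k m) * nf_comm s"
    unfolding x mult.assoc[symmetric]
    by (intro yv_mult_ymon_cong commutator_like_comm_annihilated nf_comm_commutator_like)
  then show "yv k * x \<in> mspan comm_forms"
    by (rule mspan_cong) (rule comm_formsI[OF s])
qed

lemma yword_mult_comm_forms: "f \<in> mspan comm_forms \<Longrightarrow> yword l * f \<in> mspan comm_forms"
  by (induction l) (simp_all add: yv_mult_comm_forms mult.assoc)

lemma nf_comm_in_comm_forms:
  assumes "f \<in> mspan (nf_comm ` comm_index)"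
  shows "f \<in> mspan comm_forms"
proof -
  have "1 * f \<in> mspan comm_forms"
    by (rule mspan_mult_left[OF assms]) (metis comm_formsI imageE ymon_empty)
  then show ?thesis
    by simp
qed

text \<open>
  Moving \<open>y\<^sub>k\<close> across costs a commutator, \<open>c y\<^sub>k = y\<^sub>k c + [c, y\<^sub>k]\<close>, and \<open>[c, y\<^sub>k]\<close> is again in the span
  of the commutator normal forms.
\<close>

lemma comm_forms_mult_yv:
  assumes "f \<in> mspan comm_forms"
  shows "f * yv k \<in> mspan comm_forms"
  using assms
proof (rule mspan_mult_right)
  fix x :: "'a free_alg" assume "x \<in> comm_forms"
  then obtain m s where x: "x = ymon m * nf_comm s" and s: "s \<in> comm_index"
    unfolding comm_forms_def by blast
  let ?c = "nf_comm s :: 'a free_alg"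
  have "?c \<in> mspan comm_forms" "commutator ?c (yv k) \<in> mspan comm_forms"
    using s by (blast intro: nf_comm_in_comm_forms mspan_base nf_comm_commutator)+
  then have "yv k * ?c + commutator ?c (yv k) \<in> mspan comm_forms"
    by (intro mspan_add yv_mult_comm_forms)
  then have "?c * yv k \<in> mspan comm_forms"
    by (simp add: commutator_def)
  then show "x * yv k \<in> mspan comm_forms"
    unfolding x ymon_def mult.assoc by (rule yword_mult_comm_forms)
qed

lemma comm_forms_mult_yword: "f \<in> mspan comm_forms \<Longrightarrow> f * yword l \<in> mspan comm_forms"
  by (induction l arbitrary: f) (simp_all add: comm_forms_mult_yv mult.assoc[symmetric])

text \<open>
  Sorting a monomial leaves commutators with monomials on both sides, and these stay in the span by
  the two closure properties above.
\<close>

lemma yv_mult_yword_insort: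
  "yv k * yword l - yword (insort k l) \<in> mspan comm_forms"
proof (induction l)
  case Nil
  show ?case
    by (simp add: mspan_zero)
next
  case (Cons x l)
  have "commutator (yv k) (yv x) * yword l \<in> mspan comm_forms"
    by (intro comm_forms_mult_yword nf_comm_in_comm_forms yv_commutator_in_mspan)
  moreover have "yv x * (yv k * yword l - yword (insort k l)) \<in> mspan (comm_forms :: 'a free_alg set)"
    by (intro yv_mult_comm_forms Cons.IH)
  moreover have "yv k * (yv x * yword l) - yv x * yword (insort k l)
      = commutator (yv k) (yv x) * yword l + yv x * (yv k * yword l - yword (insort k l) :: 'a free_alg)"
    by (simp add: commutator_def algebra_simps)
  ultimately have "yv k * (yv x * yword l) - yv x * yword (insort k l)
      \<in> mspan (comm_forms :: 'a free_alg set)"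
    by (metis mspan_add)
  then show ?case
    by (simp add: mspan_zero)
qed

lemma yword_minus_ymon: "yword l - ymon (mset l) \<in> mspan comm_forms"
proof (induction l)
  case Nil
  show ?case
    by (simp add: ymon_def mspan_zero)
next
  case (Cons k l)
  have "yv k * (yword l - ymon (mset l)) \<in> mspan (comm_forms :: 'a free_alg set)"
    by (intro yv_mult_comm_forms Cons.IH)
  moreover have "yv k * ymon (mset l) - ymon (mset (k # l)) \<in> mspan (comm_forms :: 'a free_alg set)"
    using yv_mult_yword_insort[of k "sorted_list_of_multiset (mset l)", where 'a = 'a]
    by (simp add: ymon_def)
  ultimately have "yv k * (yword l - ymon (mset l)) + (yv k * ymon (mset l) - ymon (mset (k # l)))
      \<in> mspan (comm_forms :: 'a free_alg set)"
    by (rule mspan_add)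
  then show ?case
    by (simp add: algebra_simps)
qed

definition odd_comm_forms :: "'k::field free_alg set" where
  "odd_comm_forms = {ymon m * zv k * nf_comm s | m k s. s \<in> comm_index}"

lemma odd_comm_formsI:
  "s \<in> comm_index \<Longrightarrow> ymon m * (zv k * nf_comm s) \<in> mspan odd_comm_forms"
  unfolding odd_comm_forms_def mult.assoc[symmetric] by (rule mspan_base) blast

lemma zv_mult_nf_comm_annihilated: "zv k * nf_comm s \<in> comm_annihilated"
  by (intro odd_comm_annihilated parity_mult_even parity_zv commutator_like_even
      nf_comm_commutator_like)

lemma yv_mult_odd_comm_form:
  assumes "s \<in> comm_index"
  shows "yv l * (ymon m * zv k * nf_comm s) \<in> mspan odd_comm_forms"
proof -
  have "yv l * (ymon m * zv k * nf_comm s) \<approx> ymon (add_mset l m) * (zv k * nf_comm s)"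
    using yv_mult_ymon_cong[OF zv_mult_nf_comm_annihilated, of l m k s] by (simp add: mult.assoc)
  then show ?thesis
    by (rule mspan_cong) (rule odd_comm_formsI[OF assms])
qed

lemma yword_mult_odd_comm_forms:
  assumes "f \<in> mspan odd_comm_forms"
  shows "yword l * f \<in> mspan odd_comm_forms"
proof (induction l)
  case (Cons k l)
  have "yv k * (yword l * f) \<in> mspan odd_comm_forms"
    using Cons.IH
  proof (rule mspan_mult_left)
    fix x :: "'a free_alg" assume "x \<in> odd_comm_forms"
    then show "yv k * x \<in> mspan odd_comm_forms"
      using yv_mult_odd_comm_form unfolding odd_comm_forms_def by blast
  qed
  then show ?case
    by (simp add: mult.assoc)
qed (use assms in simp)

text \<open>
  Here the last relation is used: \<open>y\<^sub>l\<close> passes from the right end of \<open>z\<^sub>k c\<close> to its left end.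
\<close>

lemma odd_comm_forms_mult_yv:
  assumes "f \<in> mspan odd_comm_forms"
  shows "f * yv l \<in> mspan odd_comm_forms"
  using assms
proof (rule mspan_mult_right)
  fix x :: "'a free_alg" assume "x \<in> odd_comm_forms"
  then obtain m k s where x: "x = ymon m * zv k * nf_comm s" and s: "s \<in> comm_index"
    unfolding odd_comm_forms_def by blast
  have "commutator (zv k * nf_comm s) (yv l) \<in> (basis_ideal :: 'a free_alg set)"
    using nf_comm_commutator_like parity_yv parity_zv unfolding commutator_like_def by blast
  then have "zv k * nf_comm s * yv l \<approx> yv l * (zv k * nf_comm s :: 'a free_alg)"
    by (simp add: cong_ideal_def commutator_def)
  then have "x * yv l \<approx> ymon m * (yv l * (zv k * nf_comm s))"
    unfolding x mult.assoc[of "ymon m"] by (rule cong_mult_left)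
  moreover have "yword (sorted_list_of_multiset m @ [l]) * (zv k * nf_comm s)
      \<in> mspan odd_comm_forms"
    using odd_comm_formsI[OF s, of "{#}"] by (intro yword_mult_odd_comm_forms) simp
  ultimately show "x * yv l \<in> mspan odd_comm_forms"
    by (auto simp: ymon_def mult.assoc intro: mspan_cong)
qed

text \<open>
  The monomial between \<open>z\<^sub>k\<close> and the commutator is dissolved from its right end, by
  \<open>y\<^sub>j c = c y\<^sub>j - [c, y\<^sub>j]\<close>; the first term ends in a variable that can be moved to the far left, and
  the second has a shorter monomial in the middle.
\<close>

lemma zv_yword_nf_comm:
  assumes "f \<in> mspan (nf_comm ` comm_index)"
  shows "zv k * yword l * f \<in> mspan odd_comm_forms"
  using assms
proof (induction l arbitrary: f rule: rev_induct)
  case Nil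
  then have "zv k * f \<in> mspan odd_comm_forms"
    by (rule mspan_mult_left) (use odd_comm_formsI[of _ "{#}"] in auto)
  then show ?case
    by simp
next
  case (snoc j l)
  show ?case
    using snoc.prems
  proof (rule mspan_mult_left)
    fix c :: "'a free_alg" assume c: "c \<in> nf_comm ` comm_index"
    have "zv k * yword l * c * yv j \<in> mspan odd_comm_forms"
      by (intro odd_comm_forms_mult_yv snoc.IH mspan_base c)
    moreover have "zv k * yword l * commutator c (yv j) \<in> mspan odd_comm_forms"
      using c by (intro snoc.IH) (auto intro: nf_comm_commutator)
    ultimately have "zv k * yword l * c * yv j - zv k * yword l * commutator c (yv j)
        \<in> mspan odd_comm_forms"
      by (rule mspan_diff)
    then show "zv k * yword (l @ [j]) * c \<in> mspan odd_comm_forms"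
      by (simp add: commutator_def algebra_simps)
  qed
qed

lemma zv_mult_comm_forms:
  assumes "f \<in> mspan comm_forms"
  shows "zv k * f \<in> mspan odd_comm_forms"
  using assms
proof (rule mspan_mult_left)
  fix x :: "'a free_alg" assume "x \<in> comm_forms"
  then obtain m s where "x = ymon m * nf_comm s" "s \<in> comm_index"
    unfolding comm_forms_def by blast
  then show "zv k * x \<in> mspan odd_comm_forms"
    using zv_yword_nf_comm[OF mspan_base, of "nf_comm s" k "sorted_list_of_multiset m"]
    by (simp add: ymon_def mult.assoc)
qed

definition normal_forms :: "'k::field free_alg set" where
  "normal_forms = range ymon \<union> comm_forms \<union> {ymon m * zv k * ymon m' | m k m'. True} \<union> odd_comm_forms"

lemma yword_zv_yword:
  "yword u * zv k * yword v \<in> mspan normal_forms"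
proof -
  have "zv k * ymon (mset v) \<in> comm_annihilated"
    by (intro odd_comm_annihilated parity_mult_even parity_zv parity_ymon)
  then have "yword u * (zv k * ymon (mset v)) \<approx> ymon (mset u) * (zv k * ymon (mset v))"
    by (rule yword_cong_ymon)
  then have "yword u * (zv k * ymon (mset v)) \<in> mspan normal_forms"
    by (rule mspan_cong) (auto simp: normal_forms_def mult.assoc intro!: mspan_base)
  moreover have "yword u * (zv k * (yword v - ymon (mset v))) \<in> mspan odd_comm_forms"
    by (intro yword_mult_odd_comm_forms zv_mult_comm_forms yword_minus_ymon)
  then have "yword u * (zv k * (yword v - ymon (mset v))) \<in> mspan normal_forms"
    using mspan_mono[of odd_comm_forms normal_forms] unfolding normal_forms_def by blast
  ultimately have "yword u * (zv k * (yword v - ymon (mset v))) + yword u * (zv k * ymon (mset v))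
      \<in> mspan normal_forms"
    by (intro mspan_add)
  then show ?thesis
    by (simp add: algebra_simps)
qed

lemma word_even: "word (map Even_Var l) = (yword l :: 'k::field free_alg)"
  by (induction l) (simp_all add: word_Nil word_Cons[of _ "map Even_Var _"] yv_def)

lemma word_split:
  obtains (even) l where "w = map Even_Var l"
  | (odd) l k r where "w = map Even_Var l @ Odd_Var k # r"
proof (induction w arbitrary: thesis)
  case Nil
  show ?case
    by (rule Nil(1)[of "[]"]) simp
next
  case (Cons v w)
  show ?case
  proof (cases v)
    case (Odd_Var k)
    show ?thesis
      by (rule Cons.prems(2)[of "[]" k w]) (simp add: Odd_Var)
  next
    case (Even_Var i)
    show ?thesis
    proof (rule Cons.IH)
      fix l assume "w = map Even_Var l"
      then show thesis
        by (intro Cons.prems(1)[of "i # l"]) (simp add: Even_Var)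
    next
      fix l k r assume "w = map Even_Var l @ Odd_Var k # r"
      then show thesis
        by (intro Cons.prems(2)[of "i # l" k r]) (simp add: Even_Var)
    qed
  qed
qed

text \<open>
  Only words with at most one odd letter matter: if \<open>z\<^sub>k y\<^sup>v z\<^sub>l\<close> occurs, it is a product of two odd
  elements and the word lies in the ideal.
\<close>

lemma word_in_mspan: "word w \<in> mspan normal_forms"
proof -
  consider (none) l where "w = map Even_Var l"
    | (one) u k v where "w = map Even_Var u @ Odd_Var k # map Even_Var v"
    | (two) u k v l r where "w = map Even_Var u @ Odd_Var k # map Even_Var v @ Odd_Var l # r"
  proof (rule word_split[of w])
    fix u k r assume w: "w = map Even_Var u @ Odd_Var k # r"
    show thesis
      by (rule word_split[of r]) (use w one two in blast)+
  qed (rule none)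
  then show ?thesis
  proof cases
    case none
    have "(yword l - ymon (mset l)) + ymon (mset l) \<in> mspan normal_forms"
      using yword_minus_ymon[of l] mspan_mono[of comm_forms normal_forms]
      by (intro mspan_add) (auto simp: normal_forms_def intro: mspan_base)
    then show ?thesis
      by (simp add: none word_even)
  next
    case one
    have "word w = yword u * zv k * (yword v :: 'a free_alg)"
      by (simp only: one word_append word_Cons[of "Odd_Var k" "map Even_Var v"] word_even zv_def
          mult.assoc)
    then show ?thesis
      by (simp only: yword_zv_yword)
  next
    case two
    have "word w = yword u * (((zv k * yword v) * zv l) * (word r :: 'a free_alg))"
      by (simp only: two word_append word_Cons[of "Odd_Var k" "map Even_Var v @ Odd_Var l # r"]
          word_Cons[of "Odd_Var l" r] word_even zv_def mult.assoc)
    moreover have "(zv k * yword v) * zv l \<in> (basis_ideal :: 'a free_alg set)"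
      by (intro odd_mult_odd_ideal parity_mult_even parity_zv parity_yword)
    ultimately show ?thesis
      by (simp only: mspan_ideal ideal_mult_left ideal_mult_right)
  qed
qed

theorem normal_forms_span: "f \<in> mspan normal_forms"
proof (induction f rule: free_alg_induct)
  case (word c w)
  then show ?case
    by (subst single_eq_scalar_word) (rule mspan_scale[OF word_in_mspan])
qed (auto intro: mspan_zero mspan_add)

section \<open>Matrix form of the graded components\<close>

definition even_mat :: "'k::field \<Rightarrow> 'k \<Rightarrow> 'k \<Rightarrow> 'k^3^3" where
  "even_mat a b d = vector [vector [a, 0, 0], vector [0, b, d], vector [0, 0, a]]"

definition odd_mat :: "'k::field \<Rightarrow> 'k \<Rightarrow> 'k^3^3" where
  "odd_mat p q = vector [vector [0, p, q], 0, 0]"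

lemmas mat3_simps = vec_eq_iff forall_3 matrix_matrix_mult_def sum_3 vector_3

lemma even_mat_entries:
  "even_mat a b d $ 1 $ 2 = 0" "even_mat a b d $ 1 $ 3 = 0"
  "even_mat a b d $ 2 $ 2 = b" "even_mat a b d $ 2 $ 3 = d"
  by (simp_all add: even_mat_def mat3_simps)

lemma odd_mat_entries:
  "odd_mat p q $ 1 $ 2 = p" "odd_mat p q $ 1 $ 3 = q" "odd_mat p q $ 2 $ 2 = 0" "odd_mat p q $ 2 $ 3 = 0"
  by (simp_all add: odd_mat_def mat3_simps)

lemma mat_products:
  "even_mat a b d ** even_mat a' b' d' = even_mat (a * a') (b * b') (b * d' + d * a')"
  "odd_mat p q ** even_mat a b d = odd_mat (p * b) (p * d + q * a)"
  "even_mat a b d ** odd_mat p q = odd_mat (a * p) (a * q)"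
  "odd_mat p q ** odd_mat p' q' = 0"
  by (simp_all add: even_mat_def odd_mat_def mat3_simps)

lemma mat_diffs:
  "even_mat a b d - even_mat a' b' d' = even_mat (a - a') (b - b') (d - d')"
  "odd_mat p q - odd_mat p' q' = odd_mat (p - p') (q - q')"
  by (simp_all add: even_mat_def odd_mat_def mat3_simps)

lemma mat_one_zero: "mat 1 = even_mat 1 1 0" "even_mat 0 0 0 = 0" "odd_mat 0 0 = 0"
  by (simp_all add: even_mat_def odd_mat_def mat3_simps mat_def)

lemma A3_even_eq: "A3_even = {even_mat a b d | a b d. True}"
  by (auto simp: A3_even_iff even_mat_def mat3_simps)

lemma A3_odd_eq: "A3_odd = {odd_mat p q | p q. True}"
  by (auto simp: A3_odd_iff odd_mat_def mat3_simps)

section \<open>The basis polynomials are identities\<close>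

definition admissible :: "(gvar \<Rightarrow> 'k::field^3^3) \<Rightarrow> bool" where
  "admissible \<rho> \<longleftrightarrow> (\<forall>i. \<rho> (Even_Var i) \<in> A3_even) \<and> (\<forall>i. \<rho> (Odd_Var i) \<in> A3_odd)"

lemma graded_identities_eq:
  "graded_identities A3_even A3_odd = {f. \<forall>\<rho>. admissible \<rho> \<longrightarrow> eval_poly \<rho> f = 0}"
  by (auto simp: graded_identities_def admissible_def)

lemma eval_word_parity:
  assumes "admissible \<rho>"
  shows "eval_word \<rho> w \<in> (if even (odd_count w) then A3_even else A3_odd)"
proof (induction w)
  case Nil
  show ?case
    by (simp add: odd_count_def eval_word_def A3_even_iff mat_def)
next
  case (Cons v w)
  have "Z2_graded_algebra (algA :: ('a^3^3) set) A3_even A3_odd"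
    by (rule A3_graded)
  then show ?case
    using Cons assms unfolding Z2_graded_algebra_def admissible_def
    by (cases v) (auto simp: odd_count_def eval_word_def split: if_splits)
qed

lemma eval_poly_parity:
  assumes "admissible \<rho>" "f \<in> parity b"
  shows "eval_poly \<rho> f \<in> (if b then A3_even else A3_odd)"
proof -
  have "matsp.subspace (if b then A3_even else A3_odd :: ('a^3^3) set)"
    by (simp add: A3_even_def A3_odd_def matsp.subspace_span)
  moreover have "eval_word \<rho> w \<in> (if b then A3_even else A3_odd)" if "w \<in> Poly_Mapping.keys f" for w
    using eval_word_parity[OF assms(1), of w] parityD[OF assms(2) that] by simp
  ultimately show ?thesis
    unfolding eval_poly_def by (blast intro: matsp.subspace_sum matsp.subspace_scale)
qed

text \<open>
  Evaluating after an endomorphism is evaluating at other matrices, which are again admissible when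
  the endomorphism is graded. This makes the identities a T-ideal.
\<close>

lemma eval_poly_graded_endo:
  assumes "graded_endo \<phi>"
  shows "eval_poly \<rho> (\<phi> f) = eval_poly (\<lambda>v. eval_poly \<rho> (\<phi> (word [v]))) f"
proof -
  have add: "\<phi> (f + g) = \<phi> f + \<phi> g" and mult: "\<phi> (f * g) = \<phi> f * \<phi> g"
    and scale: "\<phi> (scalar c * f) = scalar c * \<phi> f" and one: "\<phi> 1 = 1" for f g c
    using assms by (auto simp: graded_endo_def)
  have "\<phi> 0 = 0"
    using add[of 0 0] by simp
  define \<rho>' where "\<rho>' v = eval_poly \<rho> (\<phi> (word [v]))" for v
  have "eval_poly \<rho> (\<phi> (word w)) = eval_word \<rho>' w" for w
  proof (induction w)
    case Nil
    show ?case
      by (simp add: word_Nil one eval_poly_1 eval_word_def)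
  next
    case (Cons v w)
    have "eval_poly \<rho> (\<phi> (word (v # w))) = \<rho>' v ** eval_poly \<rho> (\<phi> (word w))"
      by (subst word_Cons) (simp only: mult eval_poly_mult \<rho>'_def)
    then show ?case
      by (simp add: Cons.IH eval_word_def)
  qed
  then have "eval_poly \<rho> (\<phi> f) = eval_poly \<rho>' f"
  proof (induction f rule: free_alg_induct)
    case (word c w)
    then show ?case
      by (subst single_eq_scalar_word) (simp add: scale eval_poly_scalar eval_poly_single)
  qed (simp_all add: \<open>\<phi> 0 = 0\<close> eval_poly_zero eval_poly_add add)
  then show ?thesis
    by (simp add: \<rho>'_def[abs_def])
qed

lemma graded_T_ideal_identities: "graded_T_ideal (graded_identities A3_even A3_odd)"
proof -
  have "eval_poly \<rho> (\<phi> f) = 0"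
    if \<phi>: "graded_endo \<phi>" and f: "\<forall>\<rho>. admissible \<rho> \<longrightarrow> eval_poly \<rho> f = 0" and \<rho>: "admissible \<rho>"
    for \<phi> f and \<rho> :: "gvar \<Rightarrow> 'a^3^3"
  proof -
    have "\<phi> ` parity True \<subseteq> parity True" "\<phi> ` parity False \<subseteq> parity False"
      using \<phi> by (simp_all add: graded_endo_def free_even_eq free_odd_eq)
    then have "\<phi> (yv i) \<in> parity True" "\<phi> (zv i) \<in> parity False" for i
      using imageI[OF parity_yv, of \<phi> i] imageI[OF parity_zv, of \<phi> i] by (auto simp only:)
    then have "admissible (\<lambda>v. eval_poly \<rho> (\<phi> (word [v])))"
      using eval_poly_parity[OF \<rho>, of _ True] eval_poly_parity[OF \<rho>, of _ False]
      by (simp add: admissible_def yv_def zv_def)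
    then show ?thesis
      using f eval_poly_graded_endo[OF \<phi>, of \<rho> f] by simp
  qed
  then have "\<phi> ` graded_identities A3_even A3_odd \<subseteq> graded_identities A3_even A3_odd"
    if "graded_endo \<phi>" for \<phi> :: "'a free_alg \<Rightarrow> 'a free_alg"
    using that by (simp add: graded_identities_eq image_subset_iff)
  moreover have "two_sided_ideal (graded_identities A3_even A3_odd :: 'a free_alg set)"
    by (simp add: graded_identities_eq two_sided_ideal_def eval_poly_zero eval_poly_add eval_poly_mult)
  ultimately show ?thesis
    by (simp add: graded_T_ideal_def)
qed

lemma basis_polys_identities: "basis_polys \<subseteq> graded_identities A3_even A3_odd"
proof
  fix f :: "'k::field free_alg" assume f: "f \<in> basis_polys"
  have "eval_poly \<rho> f = 0" if "admissible \<rho>" for \<rho> :: "gvar \<Rightarrow> 'k^3^3"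
  proof -
    have "\<forall>i. \<exists>a b d. \<rho> (Even_Var i) = even_mat a b d" "\<forall>i. \<exists>p q. \<rho> (Odd_Var i) = odd_mat p q"
      using that by (simp_all add: admissible_def A3_even_eq A3_odd_eq)
    then obtain a b d p q where \<rho>: "\<And>i. \<rho> (Even_Var i) = even_mat (a i) (b i) (d i)"
      "\<And>i. \<rho> (Odd_Var i) = odd_mat (p i) (q i)"
      by metis
    have "\<exists>e. eval_poly \<rho> (commutator (yv i) (yv j)) = even_mat 0 0 e" for i j
      by (simp add: eval_poly_commutator eval_poly_yv \<rho> mat_products mat_diffs mult.commute) blast
    then obtain e where e: "\<And>i j. eval_poly \<rho> (commutator (yv i) (yv j)) = even_mat 0 0 (e i j)"
      by metis
    have "eval_poly \<rho> (zv 1 * commutator (yv 1) (yv 2)) = odd_mat 0 (p 1 * e 1 2)"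
      by (simp add: eval_poly_mult e eval_poly_zv \<rho> mat_products)
    then have "eval_poly \<rho> (commutator (zv 1 * commutator (yv 1) (yv 2)) (yv 3)) = 0"
      by (simp add: eval_poly_commutator[of _ "_ * _"] eval_poly_yv \<rho> mat_products mat_diffs
          mult.commute mat_one_zero)
    then show ?thesis
      using f by (auto simp: basis_polys_def eval_poly_mult e eval_poly_zv \<rho> mat_products
          mat_one_zero)
  qed
  then show "f \<in> graded_identities A3_even A3_odd"
    by (simp add: graded_identities_eq)
qed

lemma basis_ideal_subset_identities: "basis_ideal \<subseteq> graded_identities A3_even A3_odd"
  unfolding basis_ideal_def
  by (intro hull_minimal basis_polys_identities graded_T_ideal_identities)

section \<open>Independence of monomial functions\<close>

text \<open>
  Dedekind's argument: subtracting \<open>h s y\<close> times the relation from its translate by \<open>y\<close> removes the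
  character \<open>h s\<close> and multiplies the coefficient of \<open>h i\<close> by \<open>h i y - h s y\<close>, which is nonzero for a
  suitable \<open>y\<close>.
\<close>

lemma characters_independent:
  fixes h :: "'i \<Rightarrow> 'a \<Rightarrow> 'k::field"
  assumes "finite S" "inj_on h S"
    and "\<And>i x y. i \<in> S \<Longrightarrow> h i (mul x y) = h i x * h i y"
    and "\<And>i. i \<in> S \<Longrightarrow> h i e \<noteq> 0"
    and "\<And>x. (\<Sum>i\<in>S. c i * h i x) = 0"
  shows "\<forall>i\<in>S. c i = 0"
  using assms
proof (induction S arbitrary: c rule: finite_induct)
  case (insert s S)
  have "c i = 0" if i: "i \<in> S" for i
  proof -
    obtain y where y: "h i y \<noteq> h s y"
      using insert.hyps(2) insert.prems(1) i by (metis ext inj_onD insertI1 insertI2)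
    have "(\<Sum>r\<in>S. c r * (h r y - h s y) * h r x) = 0" for x
    proof -
      have "(\<Sum>r\<in>S. c r * (h r y - h s y) * h r x)
          = (\<Sum>r\<in>insert s S. c r * (h r y - h s y) * h r x)"
        using insert.hyps by simp
      also have "\<dots> = (\<Sum>r\<in>insert s S. c r * h r (mul x y) - h s y * (c r * h r x))"
        by (rule sum.cong) (simp_all add: insert.prems(2) algebra_simps)
      also have "\<dots> = 0"
        unfolding sum_subtractf sum_distrib_left[symmetric] insert.prems(4) by simp
      finally show ?thesis .
    qed
    then have "\<forall>r\<in>S. c r * (h r y - h s y) = 0"
      using insert.prems by (intro insert.IH) (auto simp: inj_on_insert)
    then show ?thesis
      using i y by auto
  qed
  moreover have "c s = 0"
    using insert.prems(4)[of e] insert.hyps insert.prems(3)[of s] calculation by simp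
  ultimately show ?case
    by blast
qed simp

definition mon_fun :: "nat multiset \<Rightarrow> (nat \<Rightarrow> 'k::field) \<Rightarrow> 'k" where
  "mon_fun m x = (\<Prod>i\<in>#m. x i)"

lemma mon_fun_simps [simp]: "mon_fun {#} x = 1" "mon_fun (add_mset i m) x = x i * mon_fun m x"
  by (simp_all add: mon_fun_def)

lemma mon_fun_mult: "mon_fun m (\<lambda>i. x i * y i) = mon_fun m x * mon_fun m y"
  by (induction m) simp_all

lemma mon_fun_one: "mon_fun m (\<lambda>i. 1) = 1"
  by (induction m) simp_all

lemma mon_fun_two: "mon_fun m (\<lambda>j. if j = i then 2 else 1) = (2 :: 'k::field) ^ count m i"
  by (induction m) simp_all

text \<open>
  Characteristic zero enters here, through powers of \<open>2\<close>: the monomial functions are distinct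
  characters because their values at the point with one coordinate \<open>2\<close> and all others \<open>1\<close> recover
  the exponents. The terms of the sum may share a monomial, so coefficients are collected.
\<close>

lemma mon_fun_pair_independent:
  fixes c :: "'i \<Rightarrow> 'k::field_char_0"
  assumes fin: "finite S"
    and zero: "\<And>x t. (\<Sum>s\<in>S. c s * (mon_fun (fst (e s)) x * mon_fun (snd (e s)) t)) = 0"
  shows "(\<Sum>s | s \<in> S \<and> e s = q. c s) = 0"
proof (cases "q \<in> e ` S")
  case True
  define h :: "nat multiset \<times> nat multiset \<Rightarrow> (nat \<Rightarrow> 'k) \<times> (nat \<Rightarrow> 'k) \<Rightarrow> 'k"
    where "h = (\<lambda>r v. mon_fun (fst r) (fst v) * mon_fun (snd r) (snd v))"
  have "inj h"
  proof (rule injI)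
    fix q r :: "nat multiset \<times> nat multiset" assume eq: "h q = h r"
    have two: "(2 :: 'k) ^ m = 2 ^ n \<longleftrightarrow> m = n" for m n :: nat
      by (metis of_nat_eq_iff of_nat_numeral of_nat_power power_inject_exp one_less_numeral_iff semiring_norm(76))
    have "count (fst q) i = count (fst r) i" "count (snd q) i = count (snd r) i" for i
      using fun_cong[OF eq, of "(\<lambda>j. if j = i then 2 else 1, \<lambda>j. 1)"]
        fun_cong[OF eq, of "(\<lambda>j. 1, \<lambda>j. if j = i then 2 else 1)"]
      by (simp_all add: h_def mon_fun_two mon_fun_one two)
    then show "q = r"
      by (simp add: prod_eq_iff multiset_eq_iff)
  qed
  have "\<forall>r\<in>e ` S. (\<Sum>s | s \<in> S \<and> e s = r. c s) = 0"
  proof (rule characters_independent[where h = h and e = "(\<lambda>i. 1, \<lambda>i. 1)"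
        and mul = "\<lambda>v w. (\<lambda>i. fst v i * fst w i, \<lambda>i. snd v i * snd w i)"])
    show "inj_on h (e ` S)"
      using \<open>inj h\<close> by (rule inj_on_subset) simp
  next
    fix v :: "(nat \<Rightarrow> 'k) \<times> (nat \<Rightarrow> 'k)"
    have "(\<Sum>r\<in>e ` S. (\<Sum>s | s \<in> S \<and> e s = r. c s) * h r v)
        = (\<Sum>r\<in>e ` S. \<Sum>s | s \<in> S \<and> e s = r. c s * h (e s) v)"
      by (simp add: sum_distrib_right)
    also have "\<dots> = (\<Sum>s\<in>S. c s * h (e s) v)"
      by (rule sum.group) (simp_all add: fin)
    also have "\<dots> = 0"
      using zero[of "fst v" "snd v"] by (simp add: h_def)
    finally show "(\<Sum>r\<in>e ` S. (\<Sum>s | s \<in> S \<and> e s = r. c s) * h r v) = 0" .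
  qed (simp_all add: fin h_def mon_fun_mult mon_fun_one)
  with True show ?thesis
    by blast
next
  case False
  then have none: "{s. s \<in> S \<and> e s = q} = {}"
    by blast
  show ?thesis
    unfolding none by simp
qed

lemma mon_fun_pair_independent_inj:
  fixes c :: "'i \<Rightarrow> 'k::field_char_0"
  assumes "finite S" "inj_on e S" "s \<in> S"
    and "\<And>x t. (\<Sum>s\<in>S. c s * (mon_fun (fst (e s)) x * mon_fun (snd (e s)) t)) = 0"
  shows "c s = 0"
proof -
  have "{r. r \<in> S \<and> e r = e s} = {s}"
    using assms(2,3) by (auto simp: inj_on_def)
  then show ?thesis
    using mon_fun_pair_independent[OF assms(1,4), of "e s"] by simp
qed

text \<open>
  The \<open>(2, 3)\<close> entry of a commutator normal form at generic even elements, with \<open>t\<close> the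
  difference of the two diagonal entries.
\<close>

fun comm_fun :: "nat \<times> nat \<times> nat multiset \<Rightarrow> (nat \<Rightarrow> 'k::field) \<Rightarrow> (nat \<Rightarrow> 'k) \<Rightarrow> 'k" where
  "comm_fun (i, j, J) d t = (d i * t j - d j * t i) * mon_fun J t"

text \<open>
  Setting \<open>d\<close> to the indicator of \<open>i\<^sub>0\<close> leaves the terms \<open>t\<^sub>j t\<^sup>J\<close> with \<open>i = i\<^sub>0\<close> and the terms \<open>- t\<^sub>i t\<^sup>J\<close>
  with \<open>j = i\<^sub>0\<close>. All indices in a term of the second sort are at least \<open>i\<^sub>0\<close>, so it cannot be the
  monomial of the chosen index, which contains \<open>j\<^sub>0 < i\<^sub>0\<close>; and a term of the first sort determines its
  index because \<open>j\<close> is the smallest entry.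
\<close>

lemma comm_fun_independent:
  fixes c :: "nat multiset \<times> nat \<times> nat \<times> nat multiset \<Rightarrow> 'k::field_char_0"
  assumes fin: "finite S" and S: "S \<subseteq> UNIV \<times> comm_index"
    and zero: "\<And>x d t. (\<Sum>s\<in>S. c s * (mon_fun (fst s) x * comm_fun (snd s) d t)) = 0"
    and s0: "s\<^sub>0 \<in> S"
  shows "c s\<^sub>0 = 0"
proof -
  obtain m\<^sub>0 i\<^sub>0 j\<^sub>0 J\<^sub>0 where s0_eq: "s\<^sub>0 = (m\<^sub>0, i\<^sub>0, j\<^sub>0, J\<^sub>0)"
    by (metis prod_cases4)
  have ij0: "j\<^sub>0 < i\<^sub>0" and J0: "\<forall>x\<in>#J\<^sub>0. j\<^sub>0 \<le> x"
    using S s0 by (auto simp: s0_eq comm_index_def)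
  \<comment> \<open>The Boolean selects one of the two terms of \<open>comm_fun\<close>; \<open>e\<close> is its monomial and \<open>c'\<close> its coefficient.\<close>
  define e where "e = (\<lambda>((m, i, j, J), b). (m :: nat multiset, add_mset (if b then j else i :: nat) J))"
  define c' where "c' = (\<lambda>((m, i, j, J), b).
      if b then (if i = i\<^sub>0 then c (m, i, j, J) else 0) else (if j = i\<^sub>0 then - c (m, i, j, J) else 0))"
  define d where "d i = (if i = i\<^sub>0 then 1 else 0 :: 'k)" for i
  have "(\<Sum>s\<in>S \<times> UNIV. c' s * (mon_fun (fst (e s)) x * mon_fun (snd (e s)) t)) = 0" for x t
  proof -
    have "(\<Sum>s\<in>S \<times> UNIV. c' s * (mon_fun (fst (e s)) x * mon_fun (snd (e s)) t))
        = (\<Sum>s\<in>S. \<Sum>b\<in>UNIV. c' (s, b) * (mon_fun (fst (e (s, b))) x * mon_fun (snd (e (s, b))) t))"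
      by (simp add: sum.cartesian_product)
    also have "\<dots> = (\<Sum>s\<in>S. c s * (mon_fun (fst s) x * comm_fun (snd s) d t))"
      by (rule sum.cong) (auto simp: UNIV_bool c'_def e_def d_def algebra_simps)
    finally show ?thesis
      by (simp add: zero)
  qed
  then have "(\<Sum>s | s \<in> S \<times> UNIV \<and> e s = (m\<^sub>0, add_mset j\<^sub>0 J\<^sub>0). c' s) = 0"
    using fin by (intro mon_fun_pair_independent) auto
  moreover have "(\<Sum>s | s \<in> S \<times> UNIV \<and> e s = (m\<^sub>0, add_mset j\<^sub>0 J\<^sub>0). c' s) = (\<Sum>s\<in>{(s\<^sub>0, True)}. c' s)"
  proof (rule sum.mono_neutral_right)
    show "finite {s. s \<in> S \<times> (UNIV :: bool set) \<and> e s = (m\<^sub>0, add_mset j\<^sub>0 J\<^sub>0)}"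
      by (rule finite_subset[of _ "S \<times> UNIV"]) (use fin in auto)
    show "{(s\<^sub>0, True)} \<subseteq> {s. s \<in> S \<times> UNIV \<and> e s = (m\<^sub>0, add_mset j\<^sub>0 J\<^sub>0)}"
      using s0 by (simp add: e_def s0_eq)
    have "c' (s, b) = 0"
      if "s \<in> S" and e: "e (s, b) = (m\<^sub>0, add_mset j\<^sub>0 J\<^sub>0)" and ne: "(s, b) \<noteq> (s\<^sub>0, True)" for s b
    proof (rule ccontr)
      assume nz: "c' (s, b) \<noteq> 0"
      obtain m i j J where s: "s = (m, i, j, J)"
        by (metis prod_cases4)
      have ij: "j < i" and J: "\<forall>x\<in>#J. j \<le> x"
        using S \<open>s \<in> S\<close> by (auto simp: s comm_index_def)
      show False
      proof (cases b)
        case True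
        then have i: "i = i\<^sub>0" and m: "m = m\<^sub>0" and jJ: "add_mset j J = add_mset j\<^sub>0 J\<^sub>0"
          using nz e by (auto simp: c'_def e_def s split: if_splits)
        have "j \<in># add_mset j\<^sub>0 J\<^sub>0" "j\<^sub>0 \<in># add_mset j J"
          using jJ by (metis union_single_eq_member add_mset_add_single union_iff insert_iff set_mset_add_mset_insert)+
        then have "j = j\<^sub>0"
          using J J0 by fastforce
        then show False
          using ne i m jJ True by (simp add: s s0_eq)
      next
        case False
        then have j: "j = i\<^sub>0" and iJ: "add_mset i J = add_mset j\<^sub>0 J\<^sub>0"
          using nz e by (auto simp: c'_def e_def s split: if_splits)
        then have "j\<^sub>0 \<in># add_mset i J"
          by simp
        then show False
          using ij J ij0 j by fastforce
      qed
    qed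
    then have "c' r = 0" if "r \<in> S \<times> UNIV" "e r = (m\<^sub>0, add_mset j\<^sub>0 J\<^sub>0)" "r \<noteq> (s\<^sub>0, True)" for r
      using that by (cases r) blast
    then show "\<forall>s\<in>{s. s \<in> S \<times> UNIV \<and> e s = (m\<^sub>0, add_mset j\<^sub>0 J\<^sub>0)} - {(s\<^sub>0, True)}. c' s = 0"
      by blast
  qed
  ultimately show ?thesis
    by (simp add: c'_def s0_eq)
qed

section \<open>Values of the normal forms at a generic point\<close>

text \<open>
  The \<open>(1, 3)\<close> entry of the odd elements can be kept at \<open>0\<close>: their \<open>(1, 2)\<close> entry already separates
  the normal forms that contain an odd variable.
\<close>

definition generic_point ::
    "(nat \<Rightarrow> 'k::field) \<Rightarrow> (nat \<Rightarrow> 'k) \<Rightarrow> (nat \<Rightarrow> 'k) \<Rightarrow> (nat \<Rightarrow> 'k) \<Rightarrow> gvar \<Rightarrow> 'k^3^3" where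
  "generic_point a b d p v = (case v of
     Even_Var i \<Rightarrow> even_mat (a i) (b i) (d i) | Odd_Var i \<Rightarrow> odd_mat (p i) 0)"

lemma admissible_generic_point: "admissible (generic_point a b d p)"
  by (auto simp: admissible_def generic_point_def A3_even_eq A3_odd_eq)

lemma eval_generic_vars:
  "eval_poly (generic_point a b d p) (yv i) = even_mat (a i) (b i) (d i)"
  "eval_poly (generic_point a b d p) (zv i) = odd_mat (p i) 0"
  by (simp_all add: eval_poly_yv eval_poly_zv generic_point_def)

lemma eval_ymon:
  obtains e where "eval_poly (generic_point a b d p) (ymon m) = even_mat (mon_fun m a) (mon_fun m b) e"
proof -
  have "\<exists>e. eval_poly (generic_point a b d p) (yword l)
      = even_mat (mon_fun (mset l) a) (mon_fun (mset l) b) e" for l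
    by (induction l) (auto simp: eval_poly_1 mat_one_zero eval_poly_mult eval_generic_vars mat_products)
  from this[of "sorted_list_of_multiset m"] show ?thesis
    using that by (auto simp: ymon_def)
qed

lemma eval_nf_comm:
  "eval_poly (generic_point a b d p) (nf_comm s) = even_mat 0 0 (comm_fun s d (\<lambda>i. a i - b i))"
proof -
  let ?\<rho> = "generic_point a b d p" and ?t = "\<lambda>i. a i - b i"
  obtain i j J where s: "s = (i, j, J)"
    by (metis prod_cases3)
  have "eval_poly ?\<rho> (iter_comm (commutator (yv i) (yv j)) l)
      = even_mat 0 0 ((d i * ?t j - d j * ?t i) * mon_fun (mset l) ?t)" for l
  proof (induction l)
    case Nil
    show ?case
      by (simp add: eval_poly_commutator eval_generic_vars mat_products mat_diffs mult.commute)
        (rule arg_cong[where f = "even_mat 0 0"], simp add: right_diff_distrib mult.commute)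
  next
    case (Cons k l)
    have "eval_poly ?\<rho> (iter_comm (commutator (yv i) (yv j)) (k # l))
        = even_mat 0 0 ((d i * ?t j - d j * ?t i) * mon_fun (mset l) ?t * a k
            - b k * ((d i * ?t j - d j * ?t i) * mon_fun (mset l) ?t))"
      unfolding iter_comm.simps eval_poly_commutator[of _ "iter_comm _ _"] Cons.IH
      by (simp add: eval_generic_vars mat_products mat_diffs)
    then show ?case
      by (simp add: left_diff_distrib right_diff_distrib mult_ac)
  qed
  then show ?thesis
    by (simp add: s nf_comm_eq)
qed

lemma eval_comm_form:
  "eval_poly (generic_point a b d p) (ymon m * nf_comm s)
     = even_mat 0 0 (mon_fun m b * comm_fun s d (\<lambda>i. a i - b i))"
  by (rule eval_ymon[of a b d p m]) (simp add: eval_poly_mult eval_nf_comm mat_products)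

lemma eval_odd_form:
  obtains e where "eval_poly (generic_point a b d p) (ymon m * zv k * ymon m')
     = odd_mat (mon_fun m a * p k * mon_fun m' b) e"
proof -
  obtain e where "eval_poly (generic_point a b d p) (ymon m) = even_mat (mon_fun m a) (mon_fun m b) e"
    by (rule eval_ymon)
  moreover obtain e' where
    "eval_poly (generic_point a b d p) (ymon m') = even_mat (mon_fun m' a) (mon_fun m' b) e'"
    by (rule eval_ymon)
  ultimately show ?thesis
    by (intro that) (simp add: eval_poly_mult eval_generic_vars mat_products)
qed

lemma eval_odd_comm_form:
  "eval_poly (generic_point a b d p) (ymon m * zv k * nf_comm s)
     = odd_mat 0 (mon_fun m a * p k * comm_fun s d (\<lambda>i. a i - b i))"
  by (rule eval_ymon[of a b d p m])
    (simp add: eval_poly_mult eval_nf_comm eval_generic_vars mat_products)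

section \<open>Every graded identity lies in the T-ideal\<close>

lemma span_image_sum:
  assumes "f \<in> falg.span (g ` X)"
  obtains T c where "finite T" "T \<subseteq> X" "f = (\<Sum>x\<in>T. scalar (c x) * g x)"
proof -
  obtain U r where U: "finite U" "U \<subseteq> g ` X" and f: "f = (\<Sum>u\<in>U. scalar (r u) * u)"
    using assms unfolding falg.span_explicit by blast
  obtain T where T: "T \<subseteq> X" "inj_on g T" "U = g ` T"
    using U(2) by (auto simp: subset_image_inj)
  show thesis
  proof
    show "finite T"
      using U(1) T by (simp add: finite_image_iff)
    show "T \<subseteq> X"
      by (rule T(1))
    show "f = (\<Sum>x\<in>T. scalar (r (g x)) * g x)"
      unfolding f T(3) by (simp add: sum.reindex T(2))
  qed
qed

lemma eval_sum_entry:
  "eval_poly \<rho> (\<Sum>x\<in>T. scalar (c x) * g x) $ i $ j = (\<Sum>x\<in>T. c x * eval_poly \<rho> (g x) $ i $ j)"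
  by (simp add: eval_poly_sum eval_poly_scalar mscale_def)

text \<open>
  Taking the indicator of \<open>k\<close> for the entries of the odd variables isolates the normal forms that
  contain \<open>z\<^sub>k\<close>.
\<close>

lemma sum_select_middle:
  fixes f :: "'a \<times> 'b \<times> 'c \<Rightarrow> 'k::semiring_1"
  assumes "finite S"
  shows "(\<Sum>s\<in>S. f s * (if fst (snd s) = k then 1 else 0))
       = (\<Sum>r\<in>{r. (fst r, k, snd r) \<in> S}. f (fst r, k, snd r))"
proof -
  let ?T = "{r. (fst r, k, snd r) \<in> S}" and ?g = "\<lambda>r. (fst r, k, snd r)"
  have "(\<Sum>s\<in>S. f s * (if fst (snd s) = k then 1 else 0))
      = (\<Sum>s\<in>?g ` ?T. f s * (if fst (snd s) = k then 1 else 0))"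
    using assms by (intro sum.mono_neutral_right) (auto simp: image_iff)
  also have "\<dots> = (\<Sum>r\<in>?T. f (?g r))"
    by (subst sum.reindex) (auto simp: inj_on_def prod_eq_iff)
  finally show ?thesis .
qed

lemma finite_select_middle:
  assumes "finite S"
  shows "finite {r. (fst r, k, snd r) \<in> S}"
proof (rule finite_imageD)
  show "finite ((\<lambda>r. (fst r, k, snd r)) ` {r. (fst r, k, snd r) \<in> S})"
    by (rule finite_subset[OF _ assms]) auto
qed (auto simp: inj_on_def prod_eq_iff)

lemma normal_forms_images:
  "comm_forms = (\<lambda>(m, s). ymon m * nf_comm s) ` (UNIV \<times> comm_index)"
  "{ymon m * zv k * ymon m' | m k m'. True} = range (\<lambda>(m, k, m'). ymon m * zv k * ymon m')"
  "odd_comm_forms = (\<lambda>(m, k, s). ymon m * zv k * nf_comm s) ` (UNIV \<times> UNIV \<times> comm_index)"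
  unfolding comm_forms_def odd_comm_forms_def
  by (auto simp: image_iff Bex_def) blast+

lemma span_normal_forms_sum:
  fixes f :: "'k::field free_alg"
  obtains r T\<^sub>0 c\<^sub>0 T\<^sub>1 c\<^sub>1 T\<^sub>2 c\<^sub>2 T\<^sub>3 c\<^sub>3
  where "r \<in> basis_ideal" "finite T\<^sub>0" "finite T\<^sub>1" "finite T\<^sub>2" "finite T\<^sub>3"
    "T\<^sub>1 \<subseteq> UNIV \<times> comm_index" "T\<^sub>3 \<subseteq> UNIV \<times> UNIV \<times> comm_index"
    "f = (\<Sum>m\<in>T\<^sub>0. scalar (c\<^sub>0 m) * ymon m)
       + (\<Sum>x\<in>T\<^sub>1. scalar (c\<^sub>1 x) * (case x of (m, s) \<Rightarrow> ymon m * nf_comm s))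
       + (\<Sum>x\<in>T\<^sub>2. scalar (c\<^sub>2 x) * (case x of (m, k, m') \<Rightarrow> ymon m * zv k * ymon m'))
       + (\<Sum>x\<in>T\<^sub>3. scalar (c\<^sub>3 x) * (case x of (m, k, s) \<Rightarrow> ymon m * zv k * nf_comm s)) + r"
proof -
  have "f \<in> falg.span (normal_forms \<union> basis_ideal)"
    using normal_forms_span[of f] by (simp add: mspan_def)
  then obtain f\<^sub>0 f\<^sub>1 f\<^sub>2 f\<^sub>3 r where f: "f = f\<^sub>0 + f\<^sub>1 + f\<^sub>2 + f\<^sub>3 + r"
    and f0: "f\<^sub>0 \<in> falg.span (range ymon)"
    and f1: "f\<^sub>1 \<in> falg.span ((\<lambda>(m, s). ymon m * nf_comm s) ` (UNIV \<times> comm_index))"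
    and f2: "f\<^sub>2 \<in> falg.span (range (\<lambda>(m, k, m'). ymon m * zv k * ymon m'))"
    and f3: "f\<^sub>3 \<in> falg.span ((\<lambda>(m, k, s). ymon m * zv k * nf_comm s) ` (UNIV \<times> UNIV \<times> comm_index))"
    and r: "r \<in> falg.span basis_ideal"
    unfolding normal_forms_def normal_forms_images falg.span_Un by blast
  obtain T\<^sub>0 c\<^sub>0 where 0: "finite T\<^sub>0" "f\<^sub>0 = (\<Sum>m\<in>T\<^sub>0. scalar (c\<^sub>0 m) * ymon m)"
    using f0 by (rule span_image_sum)
  obtain T\<^sub>1 c\<^sub>1 where 1: "finite T\<^sub>1" "T\<^sub>1 \<subseteq> UNIV \<times> comm_index"
    "f\<^sub>1 = (\<Sum>x\<in>T\<^sub>1. scalar (c\<^sub>1 x) * (case x of (m, s) \<Rightarrow> ymon m * nf_comm s))"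
    using f1 by (rule span_image_sum)
  obtain T\<^sub>2 c\<^sub>2 where 2: "finite T\<^sub>2"
    "f\<^sub>2 = (\<Sum>x\<in>T\<^sub>2. scalar (c\<^sub>2 x) * (case x of (m, k, m') \<Rightarrow> ymon m * zv k * ymon m'))"
    using f2 by (rule span_image_sum)
  obtain T\<^sub>3 c\<^sub>3 where 3: "finite T\<^sub>3" "T\<^sub>3 \<subseteq> UNIV \<times> UNIV \<times> comm_index"
    "f\<^sub>3 = (\<Sum>x\<in>T\<^sub>3. scalar (c\<^sub>3 x) * (case x of (m, k, s) \<Rightarrow> ymon m * zv k * nf_comm s))"
    using f3 by (rule span_image_sum)
  have "r \<in> basis_ideal"
    using r falg.span_minimal[OF subset_refl ideal_subspace] by blast
  then show ?thesis
    using that[OF _ 0(1) 1(1) 2(1) 3(1) 1(2) 3(2)] f unfolding 0(2) 1(3) 2(2) 3(3) by blast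
qed

lemma identities_subset_basis_ideal:
  "graded_identities A3_even A3_odd \<subseteq> (basis_ideal :: 'k::field_char_0 free_alg set)"
proof
  fix f :: "'k free_alg" assume f: "f \<in> graded_identities A3_even A3_odd"
  obtain r T\<^sub>0 c\<^sub>0 T\<^sub>1 c\<^sub>1 T\<^sub>2 c\<^sub>2 T\<^sub>3 c\<^sub>3 where r: "r \<in> basis_ideal"
    and fin: "finite T\<^sub>0" "finite T\<^sub>1" "finite T\<^sub>2" "finite T\<^sub>3"
    and T1: "T\<^sub>1 \<subseteq> UNIV \<times> comm_index" and T3: "T\<^sub>3 \<subseteq> UNIV \<times> UNIV \<times> comm_index"
    and f_eq: "f = (\<Sum>m\<in>T\<^sub>0. scalar (c\<^sub>0 m) * ymon m)
       + (\<Sum>x\<in>T\<^sub>1. scalar (c\<^sub>1 x) * (case x of (m, s) \<Rightarrow> ymon m * nf_comm s))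
       + (\<Sum>x\<in>T\<^sub>2. scalar (c\<^sub>2 x) * (case x of (m, k, m') \<Rightarrow> ymon m * zv k * ymon m'))
       + (\<Sum>x\<in>T\<^sub>3. scalar (c\<^sub>3 x) * (case x of (m, k, s) \<Rightarrow> ymon m * zv k * nf_comm s)) + r"
    by (rule span_normal_forms_sum[of f])
  \<comment> \<open>\<open>e\<^sub>n \<rho> i j\<close> is the contribution of the \<open>n\<close>-th kind of normal form to the entry \<open>(i, j)\<close> of \<open>f\<close> at \<open>\<rho>\<close>.\<close>
  define e\<^sub>0 e\<^sub>1 e\<^sub>2 e\<^sub>3 where "e\<^sub>0 \<rho> i j = (\<Sum>m\<in>T\<^sub>0. c\<^sub>0 m * eval_poly \<rho> (ymon m) $ i $ j)"
    and "e\<^sub>1 \<rho> i j = (\<Sum>x\<in>T\<^sub>1. c\<^sub>1 x * eval_poly \<rho> (case x of (m, s) \<Rightarrow> ymon m * nf_comm s) $ i $ j)"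
    and "e\<^sub>2 \<rho> i j = (\<Sum>x\<in>T\<^sub>2. c\<^sub>2 x * eval_poly \<rho> (case x of (m, k, m') \<Rightarrow> ymon m * zv k * ymon m') $ i $ j)"
    and "e\<^sub>3 \<rho> i j = (\<Sum>x\<in>T\<^sub>3. c\<^sub>3 x * eval_poly \<rho> (case x of (m, k, s) \<Rightarrow> ymon m * zv k * nf_comm s) $ i $ j)"
    for \<rho> :: "gvar \<Rightarrow> 'k^3^3" and i j
  note e_defs = e\<^sub>0_def e\<^sub>1_def e\<^sub>2_def e\<^sub>3_def
  have entry: "e\<^sub>0 \<rho> i j + e\<^sub>1 \<rho> i j + e\<^sub>2 \<rho> i j + e\<^sub>3 \<rho> i j = 0" if "admissible \<rho>" for \<rho> i j
  proof -
    have "eval_poly \<rho> f = 0" "eval_poly \<rho> r = 0"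
      using f r basis_ideal_subset_identities that by (auto simp: graded_identities_eq)
    then have "eval_poly \<rho> (f - r) $ i $ j = 0"
      by (simp add: eval_poly_diff)
    then show ?thesis
      by (simp add: f_eq eval_poly_add eval_sum_entry e_defs)
  qed
  have ymon_entries:
    "eval_poly (generic_point a b d p) (ymon m) $ 1 $ 2 = 0"
    "eval_poly (generic_point a b d p) (ymon m) $ 1 $ 3 = 0"
    "eval_poly (generic_point a b d p) (ymon m) $ 2 $ 2 = mon_fun m b" for a b d p m
    by (rule eval_ymon[of a b d p m], simp add: even_mat_entries)+
  have odd_form_entries:
    "eval_poly (generic_point a b d p) (ymon m * zv k * ymon m') $ 1 $ 2 = mon_fun m a * p k * mon_fun m' b"
    "eval_poly (generic_point a b d p) (ymon m * zv k * ymon m') $ 2 $ 2 = 0"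
    "eval_poly (generic_point a b d p) (ymon m * zv k * ymon m') $ 2 $ 3 = 0" for a b d p m k m'
    by (rule eval_odd_form[of a b d p m k m'], simp add: odd_mat_entries)+
  note entries = ymon_entries odd_form_entries eval_comm_form eval_odd_comm_form even_mat_entries
    odd_mat_entries
  \<comment> \<open>The order matters: a kind that has been eliminated no longer disturbs the entries used later.\<close>
  have c0: "c\<^sub>0 m = 0" if "m \<in> T\<^sub>0" for m
  proof (rule mon_fun_pair_independent_inj[OF fin(1) _ that, where e = "\<lambda>m. ({#}, m)"])
    fix x t :: "nat \<Rightarrow> 'k"
    show "(\<Sum>m\<in>T\<^sub>0. c\<^sub>0 m * (mon_fun (fst ({#}, m)) x * mon_fun (snd ({#}, m)) t)) = 0"
      using entry[OF admissible_generic_point[of x t x x], of 2 2]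
      by (simp add: e_defs entries case_prod_unfold)
  qed (simp add: inj_on_def)
  then have e0: "e\<^sub>0 \<rho> i j = 0" for \<rho> i j
    by (simp add: e\<^sub>0_def)
  have c2: "c\<^sub>2 (m, k, m') = 0" if mem: "(m, k, m') \<in> T\<^sub>2" for m k m'
  proof -
    define p where "p l = (if l = k then 1 else 0 :: 'k)" for l
    have "(\<Sum>q\<in>{q. (fst q, k, snd q) \<in> T\<^sub>2}. c\<^sub>2 (fst q, k, snd q) * (mon_fun (fst q) x * mon_fun (snd q) t)) = 0"
      for x t
    proof -
      have "(\<Sum>s\<in>T\<^sub>2. c\<^sub>2 s * (mon_fun (fst s) x * p (fst (snd s)) * mon_fun (snd (snd s)) t)) = 0"
        using entry[OF admissible_generic_point[of x t x p], of 1 2]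
        by (simp add: e_defs entries case_prod_unfold)
      then have "(\<Sum>s\<in>T\<^sub>2. c\<^sub>2 s * (mon_fun (fst s) x * mon_fun (snd (snd s)) t) * p (fst (snd s))) = 0"
        by (simp add: mult_ac)
      then show ?thesis
        unfolding p_def sum_select_middle[OF fin(3)] by simp
    qed
    then have "c\<^sub>2 (fst (m, m'), k, snd (m, m')) = 0"
      using mem by (intro mon_fun_pair_independent_inj[where e = id
            and c = "\<lambda>q. c\<^sub>2 (fst q, k, snd q)", OF finite_select_middle[OF fin(3)]]) simp_all
    then show ?thesis
      by simp
  qed
  then have e2: "e\<^sub>2 \<rho> i j = 0" for \<rho> i j
    by (auto simp: e\<^sub>2_def intro!: sum.neutral)
  \<comment> \<open>The points are chosen so that \<open>a - b = t\<close>, with \<open>b = x\<close> here and \<open>a = x\<close> in the last step.\<close>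
  have c1: "c\<^sub>1 s = 0" if "s \<in> T\<^sub>1" for s
  proof (rule comm_fun_independent[OF fin(2) T1 _ that])
    fix x d t :: "nat \<Rightarrow> 'k"
    show "(\<Sum>s\<in>T\<^sub>1. c\<^sub>1 s * (mon_fun (fst s) x * comm_fun (snd s) d t)) = 0"
      using entry[OF admissible_generic_point[of "\<lambda>i. x i + t i" x d x], of 2 3]
      by (simp add: e0 e2 e\<^sub>1_def e\<^sub>3_def entries case_prod_unfold)
  qed
  have c3: "c\<^sub>3 (m, k, s) = 0" if mem: "(m, k, s) \<in> T\<^sub>3" for m k s
  proof -
    define p where "p l = (if l = k then 1 else 0 :: 'k)" for l
    have "(\<Sum>q\<in>{q. (fst q, k, snd q) \<in> T\<^sub>3}. c\<^sub>3 (fst q, k, snd q) * (mon_fun (fst q) x * comm_fun (snd q) d t)) = 0"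
      for x d t
    proof -
      have "(\<Sum>s\<in>T\<^sub>3. c\<^sub>3 s * (mon_fun (fst s) x * p (fst (snd s)) * comm_fun (snd (snd s)) d t)) = 0"
        using entry[OF admissible_generic_point[of x "\<lambda>i. x i - t i" d p], of 1 3]
        by (simp add: e0 e2 e\<^sub>1_def e\<^sub>3_def entries case_prod_unfold)
      then have "(\<Sum>s\<in>T\<^sub>3. c\<^sub>3 s * (mon_fun (fst s) x * comm_fun (snd (snd s)) d t) * p (fst (snd s))) = 0"
        by (simp add: mult_ac)
      then show ?thesis
        unfolding p_def sum_select_middle[OF fin(4)] by simp
    qed
    moreover have "{q. (fst q, k, snd q) \<in> T\<^sub>3} \<subseteq> UNIV \<times> comm_index"
      using T3 by (auto simp: mem_Times_iff)
    ultimately have "c\<^sub>3 (fst (m, s), k, snd (m, s)) = 0"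
      using mem by (intro comm_fun_independent[where c = "\<lambda>q. c\<^sub>3 (fst q, k, snd q)",
            OF finite_select_middle[OF fin(4)]]) simp_all
    then show ?thesis
      by simp
  qed
  have "c\<^sub>2 x = 0" if "x \<in> T\<^sub>2" for x
    using c2 that by (cases x) blast
  moreover have "c\<^sub>3 x = 0" if "x \<in> T\<^sub>3" for x
    using c3 that by (cases x) blast
  ultimately have "f = r"
    unfolding f_eq using c0 c1 by (simp add: scalar_def)
  then show "f \<in> basis_ideal"
    using r by simp
qed

theorem theorem4:
  shows "graded_T_ideal hull
           {zv 1 * zv 2,
            commutator (yv 1) (yv 2) * commutator (yv 3) (yv 4),
            commutator (yv 1) (yv 2) * zv 1,
            commutator (zv 1 * commutator (yv 1) (yv 2)) (yv 3)}
         = (graded_identities A3_even A3_odd :: 'k::field_char_0 free_alg set)"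
  using basis_ideal_subset_identities identities_subset_basis_ideal
  unfolding basis_ideal_def basis_polys_def by (rule subset_antisym)

end
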